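(* Let $A\subseteq B\subseteq\{0,1\}$ and let $f:X\to Y$ be a map in $\mathsf{cSet}_A^+$. Then $f$ is isomorphic (as an object of the arrow category) to the image under $i^*$ of a map $\overline f:\overline X\to\overline Y$ in $\mathsf{cSet}_B^+$ if and only if $X$ and $Y$ admit strong connection structures $\Gamma_X,\Gamma_Y$ (with respect to $\Box_B$) such that $$f\circ\Gamma_X=\Gamma_Y\circ i^*i_!f .$$ Moreover, in this situation, $\Gamma_X$ and $\Gamma_Y$ are isomorphic to the images under $i^*$ of the components of the counit $\epsilon$ of $i_!\dashv i^*$ at $\overline X$ and $\overline Y$ respectively; that is, (for corresponding choices of $\Gamma_X,\Gamma_Y$ and of $\overline f$) there are isomorphisms $\alpha:i^*\overline X\cong X$ and $\beta:i^*\overline Y\cong Y$ with $f\alpha=\beta\, i^*\overline f$ and $$\Gamma_X\circ i^*i_!\alpha=\alpha\circ i^*\epsilon_{\overline X},\qquad \Gamma_Y\circ i^*i_!\beta=\beta\circ i^*\epsilon_{\overline Y},$$ so that the cube with faces formed by these squares, the square $f\Gamma_X=\Gamma_Y\,i^*i_!f$, and the naturality square of $i^*\epsilon$ at $\overline f$ commutes.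
   Context: **Cubical sets.** For $A\subseteq\{0,1\}$, $\Box_A$ is the subcategory of the category of posets with objects $[1]^n$ ($n\ge 0$, $[1]=\{0<1\}$) and morphisms generated under composition by: faces $\partial_{i,\varepsilon}:[1]^{n-1}\to[1]^n$ ($1\le i\le n$, $\varepsilon\in\{0,1\}$; insert $\varepsilon$ as $i$-th coordinate); degeneracies $\sigma_i:[1]^n\to[1]^{n-1}$ ($1\le i\le n$; delete the $i$-th coordinate); and, for each $\varepsilon\in A$, connections $\gamma_{i,\varepsilon}:[1]^n\to[1]^{n-1}$ ($1\le i\le n-1$; replace $x_i,x_{i+1}$ by $\max\{x_i,x_{i+1}\}$ if $\varepsilon=0$, by $\min\{x_i,x_{i+1}\}$ if $\varepsilon=1$). $\mathsf{cSet}_A$ is the category of presheaves of sets on $\Box_A$, $\Box^n_A$ the representable at $[1]^n$; elements of $X_n=X([1]^n)$ are $n$-cubes, and structure maps act on the right ($x\mapsto x\phi$). A cube is degenerate if it is in the image of a degeneracy or a connection of $\Box_A$. **Marked cubical sets.** An object of $\mathsf{cSet}_A^+$ is a pair $(X,eX)$ with $X\in\mathsf{cSet}_A$ and $eX\subseteq\bigcup_{n\ge1}X_n$ a set of "marked" cubes containing all degenerate cubes; morphisms are cubical maps preserving marked cubes. **Adjunction.** For $A\subseteq B$, the inclusion $i:\Box_A\hookrightarrow\Box_B$ induces $i^*:\mathsf{cSet}_B^+\to\mathsf{cSet}_A^+$, which restricts structure maps, keeping the same cubes and the same marked cubes. $i_!$ denotes its left adjoint, $\eta:\mathrm{id}\Rightarrow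 i^*i_!$ the unit and $\epsilon:i_!i^*\Rightarrow\mathrm{id}$ the counit. **Connection structures.** A weak connection structure on $X\in\mathsf{cSet}_A^+$ (with respect to $\Box_B$) is a map $\Gamma_X:i^*i_!X\to X$ in $\mathsf{cSet}_A^+$ with $\Gamma_X\circ\eta_X=\mathrm{id}_X$. For an $n$-cube $x$ of $X$ and $\phi:[1]^m\to[1]^n$ in $\Box_B$, let $x(\phi)$ be the $m$-cube $\Gamma_X(\eta_X(x)\phi)$ of $X$, where $\eta_X(x)\phi$ is computed using the structure map $\phi$ of $i_!X$. A strong connection structure is a weak connection structure such that $x(\phi)(\psi)=x(\phi\psi)$ for all $n$-cubes $x$ of $X$ and all $\phi:[1]^m\to[1]^n$, $\psi:[1]^k\to[1]^m$ in $\Box_B$. *)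

theory Defs
  imports "HOL-Library.FuncSet" "HOL-Library.Countable_Set"
begin

section \<open>The box categories\<close>

text \<open>
  The poset \<open>[1]\<close> is \<^typ>\<open>bool\<close> with \<^prop>\<open>False < True\<close>, so that the signs \<open>0, 1\<close> are the
  booleans \<^term>\<open>False\<close>, \<^term>\<open>True\<close> and a subset of \<open>{0, 1}\<close> is an element of
  \<^typ>\<open>bool set\<close>. The object \<open>[1]\<^sup>n\<close> is the set of lists of length \<open>n\<close>; maps of posets out of it
  are extensional functions, hence equal iff they agree on \<open>[1]\<^sup>n\<close>. Coordinates are numbered from 1,
  but list positions from 0.
\<close>

type_synonym vertex = "bool list"

definition cube :: "nat \<Rightarrow> vertex set" where
  "cube n = {v. length v = n}"

definition box_id :: "nat \<Rightarrow> vertex \<Rightarrow> vertex" where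
  "box_id n = (\<lambda>v\<in>cube n. v)"

definition face :: "nat \<Rightarrow> nat \<Rightarrow> bool \<Rightarrow> vertex \<Rightarrow> vertex" where
  "face n i e = (\<lambda>v\<in>cube (n - 1). take (i - 1) v @ [e] @ drop (i - 1) v)"

definition degeneracy :: "nat \<Rightarrow> nat \<Rightarrow> vertex \<Rightarrow> vertex" where
  "degeneracy n i = (\<lambda>v\<in>cube n. take (i - 1) v @ drop i v)"

definition connection :: "nat \<Rightarrow> nat \<Rightarrow> bool \<Rightarrow> vertex \<Rightarrow> vertex" where
  "connection n i e = (\<lambda>v\<in>cube n.
     take (i - 1) v @ [(if e then min else max) (v ! (i - 1)) (v ! i)] @ drop (i + 1) v)"

inductive_set Box :: "bool set \<Rightarrow> (nat \<times> nat \<times> (vertex \<Rightarrow> vertex)) set" for A :: "bool set" where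
  Box_id: "(n, n, box_id n) \<in> Box A"
| Box_face: "1 \<le> i \<Longrightarrow> i \<le> n \<Longrightarrow> (n - 1, n, face n i e) \<in> Box A"
| Box_degeneracy: "1 \<le> i \<Longrightarrow> i \<le> n \<Longrightarrow> (n, n - 1, degeneracy n i) \<in> Box A"
| Box_connection: "e \<in> A \<Longrightarrow> 1 \<le> i \<Longrightarrow> i \<le> n - 1 \<Longrightarrow> (n, n - 1, connection n i e) \<in> Box A"
| Box_comp: "(k, m, \<psi>) \<in> Box A \<Longrightarrow> (m, n, \<phi>) \<in> Box A \<Longrightarrow> (k, n, compose (cube k) \<phi> \<psi>) \<in> Box A"

definition box_hom :: "bool set \<Rightarrow> nat \<Rightarrow> nat \<Rightarrow> (vertex \<Rightarrow> vertex) set" where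
  "box_hom A m n = {\<phi>. (m, n, \<phi>) \<in> Box A}"


section \<open>Marked cubical sets\<close>

text \<open>
  The type parameter \<open>'u\<close> plays the role of the universe of sets: cubes of all cubical sets under
  consideration are elements of \<open>'u\<close>. The structure map of \<open>\<phi> : [1]\<^sup>m \<rightarrow> [1]\<^sup>n\<close> is \<open>act X m n \<phi>\<close>;
  it takes \<open>n\<close>-cubes to \<open>m\<close>-cubes.
\<close>

record 'u mcset =
  cubes :: "nat \<Rightarrow> 'u set"
  act :: "nat \<Rightarrow> nat \<Rightarrow> (vertex \<Rightarrow> vertex) \<Rightarrow> 'u \<Rightarrow> 'u"
  marked :: "nat \<Rightarrow> 'u set"

type_synonym 'u cmap = "nat \<Rightarrow> 'u \<Rightarrow> 'u"

definition degenerate_cubes :: "bool set \<Rightarrow> 'u mcset \<Rightarrow> nat \<Rightarrow> 'u set" where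
  "degenerate_cubes A X n =
     {act X n (n - 1) (degeneracy n i) y | i y. 1 \<le> i \<and> i \<le> n \<and> y \<in> cubes X (n - 1)} \<union>
     {act X n (n - 1) (connection n i e) y | i e y.
        e \<in> A \<and> 1 \<le> i \<and> i \<le> n - 1 \<and> y \<in> cubes X (n - 1)}"

text \<open>
  \<open>act\<close> is required to be undefined outside of \<^const>\<open>box_hom\<close> \<open>A\<close> (and outside the carriers), so that
  marked cubical sets with the same cubes, structure maps and markings are equal.
\<close>

definition mcSet :: "bool set \<Rightarrow> 'u mcset set" where
  "mcSet A = {X.
     (\<forall>m n. \<forall>\<phi>\<in>box_hom A m n. act X m n \<phi> \<in> cubes X n \<rightarrow>\<^sub>E cubes X m) \<and>
     (\<forall>m n \<phi>. \<phi> \<notin> box_hom A m n \<longrightarrow> act X m n \<phi> = (\<lambda>_. undefined)) \<and>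
     (\<forall>n. \<forall>x\<in>cubes X n. act X n n (box_id n) x = x) \<and>
     (\<forall>k m n. \<forall>\<phi>\<in>box_hom A m n. \<forall>\<psi>\<in>box_hom A k m. \<forall>x\<in>cubes X n.
        act X k m \<psi> (act X m n \<phi> x) = act X k n (compose (cube k) \<phi> \<psi>) x) \<and>
     marked X 0 = {} \<and>
     (\<forall>n. marked X n \<subseteq> cubes X n) \<and>
     (\<forall>n. degenerate_cubes A X n \<subseteq> marked X n)}"

definition mcHom :: "bool set \<Rightarrow> 'u mcset \<Rightarrow> 'u mcset \<Rightarrow> 'u cmap set" where
  "mcHom A X Y = {f.
     (\<forall>n. f n \<in> cubes X n \<rightarrow>\<^sub>E cubes Y n) \<and>
     (\<forall>m n. \<forall>\<phi>\<in>box_hom A m n. \<forall>x\<in>cubes X n. f m (act X m n \<phi> x) = act Y m n \<phi> (f n x)) \<and>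
     (\<forall>n. \<forall>x\<in>marked X n. f n x \<in> marked Y n)}"

definition mcId :: "'u mcset \<Rightarrow> 'u cmap" where
  "mcId X = (\<lambda>n. \<lambda>x\<in>cubes X n. x)"

text \<open>\<open>mcComp X g f\<close> is the composite \<open>g \<circ> f\<close> of maps \<open>f : X \<rightarrow> Y\<close> and \<open>g : Y \<rightarrow> Z\<close>.\<close>

definition mcComp :: "'u mcset \<Rightarrow> 'u cmap \<Rightarrow> 'u cmap \<Rightarrow> 'u cmap" where
  "mcComp X g f = (\<lambda>n. compose (cubes X n) (g n) (f n))"

definition mcIso :: "bool set \<Rightarrow> 'u mcset \<Rightarrow> 'u mcset \<Rightarrow> 'u cmap set" where
  "mcIso A X Y = {f \<in> mcHom A X Y.
     \<exists>g\<in>mcHom A Y X. mcComp X g f = mcId X \<and> mcComp Y f g = mcId Y}"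

text \<open>An isomorphism from \<open>f' : X' \<rightarrow> Y'\<close> to \<open>f : X \<rightarrow> Y\<close> in the arrow category.\<close>

definition arrow_iso :: "bool set \<Rightarrow> 'u mcset \<Rightarrow> 'u mcset \<Rightarrow> 'u cmap \<Rightarrow>
    'u mcset \<Rightarrow> 'u mcset \<Rightarrow> 'u cmap \<Rightarrow> 'u cmap \<Rightarrow> 'u cmap \<Rightarrow> bool" where
  "arrow_iso A X' Y' f' X Y f \<alpha> \<beta> \<longleftrightarrow>
     \<alpha> \<in> mcIso A X' X \<and> \<beta> \<in> mcIso A Y' Y \<and> mcComp X' f \<alpha> = mcComp X' \<beta> f'"


section \<open>The adjunction\<close>

text \<open>
  The object part of \<open>i\<^sup>*\<close>. A map of \<^term>\<open>mcSet B\<close> and its image under \<open>i\<^sup>*\<close> are the same family of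
  functions, so the action of \<open>i\<^sup>*\<close> on maps is not written.
\<close>

definition istar :: "bool set \<Rightarrow> 'u mcset \<Rightarrow> 'u mcset" where
  "istar A X = \<lparr>cubes = cubes X,
     act = (\<lambda>m n \<phi>. if \<phi> \<in> box_hom A m n then act X m n \<phi> else (\<lambda>_. undefined)),
     marked = marked X\<rparr>"

text \<open>
  \<open>L\<close>, \<open>Lm\<close> are the object and morphism parts of a functor \<open>mcSet A \<rightarrow> mcSet B\<close>, which is left adjoint
  to \<open>i\<^sup>*\<close> with unit \<open>\<eta>\<close> and counit \<open>\<epsilon>\<close>. As maps do not record their domain and codomain, \<open>Lm\<close> takes
  these as arguments: \<open>Lm X Y f : L X \<rightarrow> L Y\<close> for \<open>f : X \<rightarrow> Y\<close>.
\<close>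

locale box_adjunction =
  fixes A B :: "bool set"
    and L :: "'u mcset \<Rightarrow> 'u mcset"
    and Lm :: "'u mcset \<Rightarrow> 'u mcset \<Rightarrow> 'u cmap \<Rightarrow> 'u cmap"
    and \<eta> :: "'u mcset \<Rightarrow> 'u cmap"
    and \<epsilon> :: "'u mcset \<Rightarrow> 'u cmap"
  assumes L_obj: "X \<in> mcSet A \<Longrightarrow> L X \<in> mcSet B"
    and L_hom: "X \<in> mcSet A \<Longrightarrow> Y \<in> mcSet A \<Longrightarrow> f \<in> mcHom A X Y \<Longrightarrow>
      Lm X Y f \<in> mcHom B (L X) (L Y)"
    and L_id: "X \<in> mcSet A \<Longrightarrow> Lm X X (mcId X) = mcId (L X)"
    and L_comp: "X \<in> mcSet A \<Longrightarrow> Y \<in> mcSet A \<Longrightarrow> Z \<in> mcSet A \<Longrightarrow>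
      f \<in> mcHom A X Y \<Longrightarrow> g \<in> mcHom A Y Z \<Longrightarrow>
      Lm X Z (mcComp X g f) = mcComp (L X) (Lm Y Z g) (Lm X Y f)"
    and unit_hom: "X \<in> mcSet A \<Longrightarrow> \<eta> X \<in> mcHom A X (istar A (L X))"
    and unit_natural: "X \<in> mcSet A \<Longrightarrow> Y \<in> mcSet A \<Longrightarrow> f \<in> mcHom A X Y \<Longrightarrow>
      mcComp X (Lm X Y f) (\<eta> X) = mcComp X (\<eta> Y) f"
    and counit_hom: "V \<in> mcSet B \<Longrightarrow> \<epsilon> V \<in> mcHom B (L (istar A V)) V"
    and counit_natural: "V \<in> mcSet B \<Longrightarrow> W \<in> mcSet B \<Longrightarrow> g \<in> mcHom B V W \<Longrightarrow>
      mcComp (L (istar A V)) g (\<epsilon> V) =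
      mcComp (L (istar A V)) (\<epsilon> W) (Lm (istar A V) (istar A W) g)"
    and triangle_L: "X \<in> mcSet A \<Longrightarrow>
      mcComp (L X) (\<epsilon> (L X)) (Lm X (istar A (L X)) (\<eta> X)) = mcId (L X)"
    and triangle_istar: "V \<in> mcSet B \<Longrightarrow>
      mcComp (istar A V) (\<epsilon> V) (\<eta> (istar A V)) = mcId (istar A V)"


section \<open>Connection structures\<close>

text \<open>\<open>LX\<close> and \<open>\<eta>X\<close> stand for \<open>i\<^sub>!X\<close> and the component of the unit at \<open>X\<close>.\<close>

definition weak_connection_structure ::
    "bool set \<Rightarrow> 'u mcset \<Rightarrow> 'u cmap \<Rightarrow> 'u mcset \<Rightarrow> 'u cmap \<Rightarrow> bool" where
  "weak_connection_structure A LX \<eta>X X \<Gamma> \<longleftrightarrow>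
     \<Gamma> \<in> mcHom A (istar A LX) X \<and> mcComp X \<Gamma> \<eta>X = mcId X"

text \<open>The \<open>m\<close>-cube \<open>x(\<phi>)\<close>, for an \<open>n\<close>-cube \<open>x\<close> and \<open>\<phi> : [1]\<^sup>m \<rightarrow> [1]\<^sup>n\<close>.\<close>

definition conn_act :: "'u mcset \<Rightarrow> 'u cmap \<Rightarrow> 'u cmap \<Rightarrow>
    nat \<Rightarrow> nat \<Rightarrow> (vertex \<Rightarrow> vertex) \<Rightarrow> 'u \<Rightarrow> 'u" where
  "conn_act LX \<eta>X \<Gamma> m n \<phi> x = \<Gamma> m (act LX m n \<phi> (\<eta>X n x))"

definition strong_connection_structure ::
    "bool set \<Rightarrow> bool set \<Rightarrow> 'u mcset \<Rightarrow> 'u cmap \<Rightarrow> 'u mcset \<Rightarrow> 'u cmap \<Rightarrow> bool" where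
  "strong_connection_structure A B LX \<eta>X X \<Gamma> \<longleftrightarrow>
     weak_connection_structure A LX \<eta>X X \<Gamma> \<and>
     (\<forall>k m n. \<forall>\<phi>\<in>box_hom B m n. \<forall>\<psi>\<in>box_hom B k m. \<forall>x\<in>cubes X n.
        conn_act LX \<eta>X \<Gamma> k m \<psi> (conn_act LX \<eta>X \<Gamma> m n \<phi> x) =
        conn_act LX \<eta>X \<Gamma> k n (compose (cube k) \<phi> \<psi>) x)"

text \<open>\<open>\<Gamma>X\<close> and \<open>\<Gamma>Y\<close> are strong connection structures on \<open>X\<close> and \<open>Y\<close> with \<open>f \<circ> \<Gamma>X = \<Gamma>Y \<circ> i\<^sup>*i\<^sub>!f\<close>.\<close>

definition compatible_strong_structures :: "bool set \<Rightarrow> bool set \<Rightarrow> ('u mcset \<Rightarrow> 'u mcset) \<Rightarrow>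
    ('u mcset \<Rightarrow> 'u mcset \<Rightarrow> 'u cmap \<Rightarrow> 'u cmap) \<Rightarrow> ('u mcset \<Rightarrow> 'u cmap) \<Rightarrow>
    'u mcset \<Rightarrow> 'u mcset \<Rightarrow> 'u cmap \<Rightarrow> 'u cmap \<Rightarrow> 'u cmap \<Rightarrow> bool" where
  "compatible_strong_structures A B L Lm \<eta> X Y f \<Gamma>X \<Gamma>Y \<longleftrightarrow>
     strong_connection_structure A B (L X) (\<eta> X) X \<Gamma>X \<and>
     strong_connection_structure A B (L Y) (\<eta> Y) Y \<Gamma>Y \<and>
     mcComp (L X) f \<Gamma>X = mcComp (L X) \<Gamma>Y (Lm X Y f)"

text \<open>
  Commutativity of the cube with edges \<open>\<alpha>, \<beta>, i\<^sup>*i\<^sub>!\<alpha>, i\<^sup>*i\<^sub>!\<beta>\<close> from the naturality square of \<open>i\<^sup>*\<epsilon>\<close> at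
  \<open>f' : X' \<rightarrow> Y'\<close> to the square \<open>f \<circ> \<Gamma>X = \<Gamma>Y \<circ> i\<^sup>*i\<^sub>!f\<close>: its six faces, starting with the two which
  say that \<open>\<alpha>\<close> and \<open>\<beta>\<close> identify \<open>\<Gamma>X\<close> and \<open>\<Gamma>Y\<close> with the components of \<open>i\<^sup>*\<epsilon>\<close>.
\<close>

definition counit_cube :: "bool set \<Rightarrow> ('u mcset \<Rightarrow> 'u mcset) \<Rightarrow>
    ('u mcset \<Rightarrow> 'u mcset \<Rightarrow> 'u cmap \<Rightarrow> 'u cmap) \<Rightarrow> ('u mcset \<Rightarrow> 'u cmap) \<Rightarrow>
    'u mcset \<Rightarrow> 'u mcset \<Rightarrow> 'u cmap \<Rightarrow> 'u mcset \<Rightarrow> 'u mcset \<Rightarrow> 'u cmap \<Rightarrow>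
    'u cmap \<Rightarrow> 'u cmap \<Rightarrow> 'u cmap \<Rightarrow> 'u cmap \<Rightarrow> bool" where
  "counit_cube A L Lm \<epsilon> X' Y' f' X Y f \<Gamma>X \<Gamma>Y \<alpha> \<beta> \<longleftrightarrow>
     (let LX' = L (istar A X'); LY' = L (istar A Y');
          L\<alpha> = Lm (istar A X') X \<alpha>; L\<beta> = Lm (istar A Y') Y \<beta>;
          Lf = Lm X Y f; Lf' = Lm (istar A X') (istar A Y') f'
      in mcComp LX' \<Gamma>X L\<alpha> = mcComp LX' \<alpha> (\<epsilon> X') \<and>
         mcComp LY' \<Gamma>Y L\<beta> = mcComp LY' \<beta> (\<epsilon> Y') \<and>
         mcComp (istar A X') f \<alpha> = mcComp (istar A X') \<beta> f' \<and>
         mcComp LX' Lf L\<alpha> = mcComp LX' L\<beta> Lf' \<and>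
         mcComp (L X) f \<Gamma>X = mcComp (L X) \<Gamma>Y Lf \<and>
         mcComp LX' f' (\<epsilon> X') = mcComp LX' (\<epsilon> Y') Lf')"


section \<open>Existence of the adjunction\<close>

text \<open>
  The hypothesis \<^const>\<open>box_adjunction\<close> can be met for all \<open>A \<subseteq> B\<close> as soon as the universe \<open>'u\<close> is
  infinite: see \<open>box_adjunction_exists\<close> at the end of this section.
\<close>

lemma box_hom_comp: "\<psi> \<in> box_hom A k m \<Longrightarrow> \<phi> \<in> box_hom A m n \<Longrightarrow> compose (cube k) \<phi> \<psi> \<in> box_hom A k n"
  unfolding box_hom_def by (auto intro: Box.Box_comp)

lemma box_hom_id: "box_id n \<in> box_hom A n n"
  unfolding box_hom_def by (auto intro: Box.Box_id)

lemma box_hom_mono: "A \<subseteq> B \<Longrightarrow> \<phi> \<in> box_hom A m n \<Longrightarrow> \<phi> \<in> box_hom B m n"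
proof -
  have "A \<subseteq> B \<Longrightarrow> (m, n, \<phi>) \<in> Box A \<Longrightarrow> (m, n, \<phi>) \<in> Box B"
    by (rotate_tac, induction rule: Box.induct) (simp_all add: Box.intros subset_iff, (metis Box.intros One_nat_def)+)
  then show "A \<subseteq> B \<Longrightarrow> \<phi> \<in> box_hom A m n \<Longrightarrow> \<phi> \<in> box_hom B m n" unfolding box_hom_def by auto
qed

lemma box_hom_fun: "\<phi> \<in> box_hom A m n \<Longrightarrow> \<phi> \<in> cube m \<rightarrow>\<^sub>E cube n"
proof -
  have "(m, n, \<phi>) \<in> Box A \<Longrightarrow> \<phi> \<in> cube m \<rightarrow>\<^sub>E cube n"
  proof (induction rule: Box.induct)
    case Box_id
    then show ?case by (auto simp: box_id_def)
  next
    case Box_face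
    then show ?case unfolding face_def restrict_PiE_iff by (auto simp: cube_def)
  next
    case Box_degeneracy
    then show ?case unfolding degeneracy_def restrict_PiE_iff by (auto simp: cube_def)
  next
    case Box_connection
    then show ?case unfolding connection_def restrict_PiE_iff by (auto simp: cube_def)
  next
    case (Box_comp k m \<psi> n \<phi>)
    then show ?case unfolding compose_def by (auto dest: PiE_mem)
  qed
  then show "\<phi> \<in> box_hom A m n \<Longrightarrow> \<phi> \<in> cube m \<rightarrow>\<^sub>E cube n" by (simp add: box_hom_def)
qed

lemma box_comp_assoc:
  assumes "\<psi> \<in> box_hom A k m"
  shows "compose (cube k) (compose (cube m) \<chi> \<phi>) \<psi> = compose (cube k) \<chi> (compose (cube k) \<phi> \<psi>)"
proof -
  have "\<psi> v \<in> cube m" if "v \<in> cube k" for v using box_hom_fun[OF assms] that by blast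
  then show ?thesis by (auto simp: compose_def fun_eq_iff)
qed

lemma box_comp_id_left:
  assumes "\<phi> \<in> box_hom A m n" shows "compose (cube m) (box_id n) \<phi> = \<phi>"
proof
  fix v show "compose (cube m) (box_id n) \<phi> v = \<phi> v"
    using box_hom_fun[OF assms] by (cases "v \<in> cube m") (auto simp: compose_def box_id_def extensional_def PiE_def)
qed

lemma box_comp_id_right:
  assumes "\<phi> \<in> box_hom A m n" shows "compose (cube m) \<phi> (box_id m) = \<phi>"
proof
  fix v show "compose (cube m) \<phi> (box_id m) v = \<phi> v"
    using box_hom_fun[OF assms] by (cases "v \<in> cube m") (auto simp: compose_def box_id_def extensional_def PiE_def)
qed

lemma degeneracy_box_hom: "1 \<le> i \<Longrightarrow> i \<le> n \<Longrightarrow> degeneracy n i \<in> box_hom A n (n - 1)"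
  and connection_box_hom: "e \<in> A \<Longrightarrow> 1 \<le> i \<Longrightarrow> i \<le> n - 1 \<Longrightarrow> connection n i e \<in> box_hom A n (n - 1)"
  unfolding box_hom_def mem_Collect_eq by (rule Box.intros; assumption)+

lemma act_cubes: "X \<in> mcSet A \<Longrightarrow> \<phi> \<in> box_hom A m n \<Longrightarrow> x \<in> cubes X n \<Longrightarrow> act X m n \<phi> x \<in> cubes X m"
  unfolding mcSet_def by blast
lemma act_id: "X \<in> mcSet A \<Longrightarrow> x \<in> cubes X n \<Longrightarrow> act X n n (box_id n) x = x"
  unfolding mcSet_def by blast
lemma act_comp: "X \<in> mcSet A \<Longrightarrow> \<phi> \<in> box_hom A m n \<Longrightarrow> \<psi> \<in> box_hom A k m \<Longrightarrow> x \<in> cubes X n \<Longrightarrow>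
   act X k m \<psi> (act X m n \<phi> x) = act X k n (compose (cube k) \<phi> \<psi>) x"
  unfolding mcSet_def by blast
lemma marked_cubes: "X \<in> mcSet A \<Longrightarrow> x \<in> marked X n \<Longrightarrow> x \<in> cubes X n"
  unfolding mcSet_def by blast
lemma degenerate_marked: "X \<in> mcSet A \<Longrightarrow> x \<in> degenerate_cubes A X n \<Longrightarrow> x \<in> marked X n"
  unfolding mcSet_def by blast

lemma hom_cubes: "f \<in> mcHom A X Y \<Longrightarrow> x \<in> cubes X n \<Longrightarrow> f n x \<in> cubes Y n"
  unfolding mcHom_def by blast
lemma hom_act: "f \<in> mcHom A X Y \<Longrightarrow> \<phi> \<in> box_hom A m n \<Longrightarrow> x \<in> cubes X n \<Longrightarrow> f m (act X m n \<phi> x) = act Y m n \<phi> (f n x)"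
  unfolding mcHom_def by blast
lemma hom_marked: "f \<in> mcHom A X Y \<Longrightarrow> x \<in> marked X n \<Longrightarrow> f n x \<in> marked Y n"
  unfolding mcHom_def by blast

lemma cmap_eqI: 
  assumes "\<And>n x. x \<in> cubes X n \<Longrightarrow> f n x = g n x" "\<And>n. f n \<in> extensional (cubes X n)" "\<And>n. g n \<in> extensional (cubes X n)"
  shows "f = g"
  using assms by (intro ext) (metis extensional_arb)

lemma hom_ext: "f \<in> mcHom A X Y \<Longrightarrow> f n \<in> extensional (cubes X n)"
  unfolding mcHom_def PiE_def by blast

lemma comp_ext [simp]: "mcComp X g f n \<in> extensional (cubes X n)"
  by (simp add: mcComp_def)
lemma id_ext [simp]: "mcId X n \<in> extensional (cubes X n)"
  by (simp add: mcId_def)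
lemma comp_apply [simp]: "x \<in> cubes X n \<Longrightarrow> mcComp X g f n x = g n (f n x)"
  by (simp add: mcComp_def compose_def)
lemma id_apply' [simp]: "x \<in> cubes X n \<Longrightarrow> mcId X n x = x"
  by (simp add: mcId_def)

lemma mcHomI: 
  assumes "\<And>n. f n \<in> extensional (cubes X n)" "\<And>n x. x \<in> cubes X n \<Longrightarrow> f n x \<in> cubes Y n"
   "\<And>m n \<phi> x. \<phi> \<in> box_hom A m n \<Longrightarrow> x \<in> cubes X n \<Longrightarrow> f m (act X m n \<phi> x) = act Y m n \<phi> (f n x)"
   "\<And>n x. x \<in> marked X n \<Longrightarrow> f n x \<in> marked Y n"
  shows "f \<in> mcHom A X Y"
  unfolding mcHom_def PiE_def using assms by auto

lemma hom_id: "X \<in> mcSet A \<Longrightarrow> mcId X \<in> mcHom A X X"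
  by (intro mcHomI) (auto simp: act_cubes dest: marked_cubes)

lemma hom_comp: assumes "X \<in> mcSet A" "f \<in> mcHom A X Y" "g \<in> mcHom A Y Z" shows "mcComp X g f \<in> mcHom A X Z"
  using assms by (intro mcHomI) (auto simp: act_cubes hom_cubes hom_act hom_marked dest: marked_cubes)

lemma cubes_istar [simp]: "cubes (istar A X) = cubes X" "marked (istar A X) = marked X"
  by (auto simp: istar_def)
lemma act_istar [simp]: "\<phi> \<in> box_hom A m n \<Longrightarrow> act (istar A X) m n \<phi> = act X m n \<phi>"
  by (auto simp: istar_def)

lemma istar_mcSet:
  assumes "A \<subseteq> B" "X \<in> mcSet B" shows "istar A X \<in> mcSet A"
proof -
  note h = box_hom_mono[OF assms(1)]
  have 1: "act (istar A X) m n \<phi> \<in> cubes (istar A X) n \<rightarrow>\<^sub>E cubes (istar A X) m" if "\<phi> \<in> box_hom A m n" for m n \<phi>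
    using that assms(2) h[OF that] unfolding mcSet_def by simp
  have 2: "act (istar A X) m n \<phi> = (\<lambda>_. undefined)" if "\<phi> \<notin> box_hom A m n" for m n \<phi>
    using that by (simp add: istar_def)
  have "degenerate_cubes A (istar A X) n \<subseteq> degenerate_cubes B X n" for n
    unfolding degenerate_cubes_def using degeneracy_box_hom[of _ n A] connection_box_hom[of _ A _ n] assms(1) 
    by (auto 4 4)
  moreover have "degenerate_cubes B X n \<subseteq> marked X n" for n using assms(2) unfolding mcSet_def by blast
  ultimately have 3: "degenerate_cubes A (istar A X) n \<subseteq> marked (istar A X) n" for n by auto
  have 4: "marked X 0 = {}" "marked X n \<subseteq> cubes X n" for n using assms(2) unfolding mcSet_def by blast+
  show ?thesis unfolding mcSet_def using 1 2 3 4 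
    by (auto simp: act_id[OF assms(2)] act_comp[OF assms(2)] h box_hom_id box_hom_comp)
qed

lemma istar_mcHom: "A \<subseteq> B \<Longrightarrow> f \<in> mcHom B X Y \<Longrightarrow> f \<in> mcHom A (istar A X) (istar A Y)"
  by (intro mcHomI) (auto simp: hom_cubes hom_act hom_marked hom_ext box_hom_mono)

lemma adjunction_from_universal:
  assumes AB: "A \<subseteq> B"
    and L: "\<And>X. X \<in> mcSet A \<Longrightarrow> L X \<in> mcSet B"
    and \<eta>: "\<And>X. X \<in> mcSet A \<Longrightarrow> \<eta> X \<in> mcHom A X (istar A (L X))"
    and E: "\<And>X W g. X \<in> mcSet A \<Longrightarrow> W \<in> mcSet B \<Longrightarrow> g \<in> mcHom A X (istar A W) \<Longrightarrow> \<exists>h\<in>mcHom B (L X) W. mcComp X h (\<eta> X) = g"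
    and U: "\<And>X W h h'. X \<in> mcSet A \<Longrightarrow> W \<in> mcSet B \<Longrightarrow> h \<in> mcHom B (L X) W \<Longrightarrow> h' \<in> mcHom B (L X) W \<Longrightarrow>
       mcComp X h (\<eta> X) = mcComp X h' (\<eta> X) \<Longrightarrow> h = h'"
  shows "\<exists>Lm \<epsilon>. box_adjunction A B L Lm \<eta> \<epsilon>"
proof -
  define ex where "ex = (\<lambda>X W g. SOME h. h \<in> mcHom B (L X) W \<and> mcComp X h (\<eta> X) = g)"
  have exh: "ex X W g \<in> mcHom B (L X) W" and exe: "mcComp X (ex X W g) (\<eta> X) = g"
    if "X \<in> mcSet A" "W \<in> mcSet B" "g \<in> mcHom A X (istar A W)" for X W g
    using someI_ex[of "\<lambda>h. h \<in> mcHom B (L X) W \<and> mcComp X h (\<eta> X) = g"] E[OF that] unfolding ex_def by auto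
  have exa: "ex X W g n (\<eta> X n x) = g n x" if "X \<in> mcSet A" "W \<in> mcSet B" "g \<in> mcHom A X (istar A W)" "x \<in> cubes X n" for X W g n x
    using exe[OF that(1-3)] comp_apply[OF that(4)] by metis
  have U': "h = h'" if "X \<in> mcSet A" "W \<in> mcSet B" "h \<in> mcHom B (L X) W" "h' \<in> mcHom B (L X) W" 
     "\<And>n x. x \<in> cubes X n \<Longrightarrow> h n (\<eta> X n x) = h' n (\<eta> X n x)" for X W h h'
    by (rule U[OF that(1-4)]) (rule cmap_eqI[where X=X], auto simp: that)
  define Lm where "Lm = (\<lambda>X Y f. ex X (L Y) (mcComp X (\<eta> Y) f))"
  define \<epsilon> where "\<epsilon> = (\<lambda>W. ex (istar A W) W (mcId W))"
  note st = istar_mcSet[OF AB]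
  have tr: "mcComp X (\<eta> Y) f \<in> mcHom A X (istar A (L Y))" if "X \<in> mcSet A" "Y \<in> mcSet A" "f \<in> mcHom A X Y" for X Y f
    using hom_comp[OF that(1,3) \<eta>[OF that(2)]] .
  have Lmh: "Lm X Y f \<in> mcHom B (L X) (L Y)" if "X \<in> mcSet A" "Y \<in> mcSet A" "f \<in> mcHom A X Y" for X Y f
    unfolding Lm_def using exh[OF that(1) L[OF that(2)] tr[OF that]] .
  have Lme: "Lm X Y f n (\<eta> X n x) = \<eta> Y n (f n x)" if "X \<in> mcSet A" "Y \<in> mcSet A" "f \<in> mcHom A X Y" "x \<in> cubes X n" for X Y f n x
    unfolding Lm_def using exa[OF that(1) L[OF that(2)] tr[OF that(1-3)] that(4)] that(4) by simp
  have idh: "mcId W \<in> mcHom A (istar A W) (istar A W)" if "W \<in> mcSet B" for W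
    using istar_mcHom[OF AB hom_id[OF that]] .
  have eh: "\<epsilon> W \<in> mcHom B (L (istar A W)) W" if "W \<in> mcSet B" for W
    unfolding \<epsilon>_def using exh[OF st[OF that] that idh[OF that]] .
  have ee: "\<epsilon> W n (\<eta> (istar A W) n x) = x" if "W \<in> mcSet B" "x \<in> cubes W n" for W n x
    unfolding \<epsilon>_def using exa[OF st[OF that(1)] that(1) idh[OF that(1)], of x n] that(2) by simp
  have etc: "\<eta> X n x \<in> cubes (L X) n" if "X \<in> mcSet A" "x \<in> cubes X n" for X n x
    using hom_cubes[OF \<eta>] that by force
  have "box_adjunction A B L Lm \<eta> \<epsilon>"
  proof
    fix X Y :: "'a mcset" and f assume *: "X \<in> mcSet A" "Y \<in> mcSet A" "f \<in> mcHom A X Y"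
    show "Lm X Y f \<in> mcHom B (L X) (L Y)" using Lmh[OF *] .
    show "mcComp X (Lm X Y f) (\<eta> X) = mcComp X (\<eta> Y) f"
      by (rule cmap_eqI[where X=X]) (auto simp: Lme[OF *])
    fix Z g assume **: "Z \<in> mcSet A" "g \<in> mcHom A Y Z"
    have gf: "mcComp X g f \<in> mcHom A X Z" using hom_comp * ** by blast
    show "Lm X Z (mcComp X g f) = mcComp (L X) (Lm Y Z g) (Lm X Y f)"
      by (rule U'[OF *(1) L[OF **(1)]])
        (use * ** gf hom_cubes[OF *(3)] in \<open>auto intro!: Lmh hom_comp[OF L] simp: Lme etc\<close>)
  next
    fix X :: "'a mcset" assume X: "X \<in> mcSet A"
    show "L X \<in> mcSet B" using L X .
    show "\<eta> X \<in> mcHom A X (istar A (L X))" using \<eta> X .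
    show "Lm X X (mcId X) = mcId (L X)"
      by (rule U'[OF X L[OF X]]) (use X in \<open>auto intro!: Lmh hom_id L simp: Lme etc hom_id\<close>)
    show "mcComp (L X) (\<epsilon> (L X)) (Lm X (istar A (L X)) (\<eta> X)) = mcId (L X)"
      by (rule U'[OF X L[OF X]])
        (use X in \<open>auto intro!: hom_comp[OF L] Lmh eh hom_id L st \<eta> simp: Lme etc hom_id ee L st \<eta>\<close>)
  next
    fix V :: "'a mcset" assume V: "V \<in> mcSet B"
    show "\<epsilon> V \<in> mcHom B (L (istar A V)) V" using eh[OF V] .
    show "mcComp (istar A V) (\<epsilon> V) (\<eta> (istar A V)) = mcId (istar A V)"
      by (rule cmap_eqI[where X="istar A V"], simp add: ee[OF V], (rule comp_ext id_ext)+)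
    fix W g assume W: "W \<in> mcSet B" "g \<in> mcHom B V W"
    note g = istar_mcHom[OF AB W(2)]
    note Lmg = Lmh[OF st[OF V] st[OF W(1)] g]
    show "mcComp (L (istar A V)) g (\<epsilon> V) =
      mcComp (L (istar A V)) (\<epsilon> W) (Lm (istar A V) (istar A W) g)"
      by (rule U'[OF st[OF V] W(1)])
        (auto intro!: hom_comp[OF L[OF st[OF V]]] eh V W Lmg simp: etc st V Lme W g ee hom_cubes[OF W(2)])
  qed
  then show ?thesis by blast
qed


text \<open>
  \<open>i\<^sub>!X\<close> as a left Kan extension: an \<open>n\<close>-cube is a class of pairs of an \<open>x \<in> X\<^sub>k\<close> and a
  \<open>\<phi> : [1]\<^sup>n \<rightarrow> [1]\<^sup>k\<close> in \<open>Box B\<close>, where \<open>(x, \<psi>\<phi>)\<close> is identified with \<open>(x\<psi>, \<phi>)\<close> for \<open>\<psi>\<close> in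
  \<open>Box A\<close>; a cube is marked if it is degenerate or the image of a marked cube of \<open>X\<close>. The function
  \<open>q\<close> in the locale below encodes the classes as elements of \<open>'u\<close>.
\<close>

type_synonym 'u box_pair = "nat \<times> (vertex \<Rightarrow> vertex) \<times> 'u"

definition box_pairs :: "bool set \<Rightarrow> 'u mcset \<Rightarrow> nat \<Rightarrow> 'u box_pair set" where
  "box_pairs B X n = {(k, \<phi>, x). \<phi> \<in> box_hom B n k \<and> x \<in> cubes X k}"

definition box_step :: "bool set \<Rightarrow> bool set \<Rightarrow> 'u mcset \<Rightarrow> nat \<Rightarrow> ('u box_pair \<times> 'u box_pair) set" where
  "box_step A B X n = {((k, compose (cube n) \<psi> \<phi>, x), (m, \<phi>, act X m k \<psi> x)) | k m \<psi> \<phi> x.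
      \<phi> \<in> box_hom B n m \<and> \<psi> \<in> box_hom A m k \<and> x \<in> cubes X k}"

definition box_cong :: "bool set \<Rightarrow> bool set \<Rightarrow> 'u mcset \<Rightarrow> nat \<Rightarrow> ('u box_pair \<times> 'u box_pair) set" where
  "box_cong A B X n = (box_step A B X n \<union> (box_step A B X n)\<inverse>)\<^sup>*"

lemma box_cong_sym: "(t, t') \<in> box_cong A B X n \<Longrightarrow> (t', t) \<in> box_cong A B X n"
  unfolding box_cong_def by (metis converse_Un converse_converse rtrancl_converseI sup_commute)

lemma box_cong_inv:
  assumes "\<And>t t'. (t, t') \<in> box_step A B X n \<Longrightarrow> F t = F t'" "(t, t') \<in> box_cong A B X n"
  shows "F t = F t'"
  using assms(2) unfolding box_cong_def by (induction rule: rtrancl_induct) (use assms(1) in fastforce)+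

locale free_box =
  fixes A B :: "bool set" and X :: "'u mcset" and q :: "nat \<Rightarrow> 'u box_pair \<Rightarrow> 'u"
  assumes AB: "A \<subseteq> B" and X: "X \<in> mcSet A"
    and q: "\<And>n t t'. t \<in> box_pairs B X n \<Longrightarrow> t' \<in> box_pairs B X n \<Longrightarrow> q n t = q n t' \<longleftrightarrow> (t, t') \<in> box_cong A B X n"
begin

definition rep where "rep n z = (SOME t. t \<in> box_pairs B X n \<and> q n t = z)"
definition pre where "pre m t \<psi> = (case t of (k, \<phi>, x) \<Rightarrow> (k, compose (cube m) \<phi> \<psi>, x))"
definition LC where "LC n = q n ` box_pairs B X n"
definition Lact where "Lact m n \<psi> = (if \<psi> \<in> box_hom B m n then \<lambda>z\<in>LC n. q m (pre m (rep n z) \<psi>) else (\<lambda>_. undefined))"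
definition L0 where "L0 = \<lparr>cubes = LC, act = Lact, marked = LC\<rparr>"
definition eta where "eta = (\<lambda>n. \<lambda>x\<in>cubes X n. q n (n, box_id n, x))"
definition LX where "LX = \<lparr>cubes = LC, act = Lact, marked = (\<lambda>n. eta n ` marked X n \<union> degenerate_cubes B L0 n)\<rparr>"

lemma rep: "z \<in> LC n \<Longrightarrow> rep n z \<in> box_pairs B X n" "z \<in> LC n \<Longrightarrow> q n (rep n z) = z"
  unfolding LC_def rep_def atomize_conj by (auto intro: someI2_ex)

lemma pre_tri: "\<psi> \<in> box_hom B m n \<Longrightarrow> t \<in> box_pairs B X n \<Longrightarrow> pre m t \<psi> \<in> box_pairs B X m"
  by (auto simp: pre_def box_pairs_def box_hom_comp)

lemma pre_step:
  assumes "\<psi> \<in> box_hom B m n" "(t, t') \<in> box_step A B X n" shows "(pre m t \<psi>, pre m t' \<psi>) \<in> box_step A B X m"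
proof -
  obtain k l \<chi> \<phi> x where *: "t = (k, compose (cube n) \<chi> \<phi>, x)" "t' = (l, \<phi>, act X l k \<chi> x)" "\<phi> \<in> box_hom B n l" "\<chi> \<in> box_hom A l k" "x \<in> cubes X k"
    using assms(2) unfolding box_step_def by blast
  have "pre m t \<psi> = (k, compose (cube m) \<chi> (compose (cube m) \<phi> \<psi>), x)"
    "pre m t' \<psi> = (l, compose (cube m) \<phi> \<psi>, act X l k \<chi> x)"
    using * box_comp_assoc[OF assms(1)] by (auto simp: pre_def)
  then show ?thesis using *(3-5) box_hom_comp[OF assms(1)] unfolding box_step_def by blast
qed

lemma pre_cong:
  assumes "\<psi> \<in> box_hom B m n" "(t, t') \<in> box_cong A B X n"
  shows "(pre m t \<psi>, pre m t' \<psi>) \<in> box_cong A B X m"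
  using assms(2) unfolding box_cong_def
proof (induction rule: rtrancl_induct)
  case (step u v)
  then have "(pre m u \<psi>, pre m v \<psi>) \<in> box_step A B X m \<union> (box_step A B X m)\<inverse>" using pre_step[OF assms(1)] by blast
  then show ?case using step.IH by (rule rtrancl_into_rtrancl[rotated])
qed auto

lemma Lact_q: assumes "\<psi> \<in> box_hom B m n" "t \<in> box_pairs B X n"
  shows "Lact m n \<psi> (q n t) = q m (pre m t \<psi>)"
proof -
  have z: "q n t \<in> LC n" using assms(2) by (auto simp: LC_def)
  have "(rep n (q n t), t) \<in> box_cong A B X n" using q rep[OF z] assms(2) by blast
  then have "q m (pre m (rep n (q n t)) \<psi>) = q m (pre m t \<psi>)"
    using q[OF pre_tri[OF assms(1) rep(1)[OF z]] pre_tri[OF assms]] pre_cong[OF assms(1)] by blast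
  then show ?thesis using assms(1) z by (simp add: Lact_def)
qed

lemma pre_pre: "\<psi> \<in> box_hom B k m \<Longrightarrow> pre k (pre m t \<phi>) \<psi> = pre k t (compose (cube k) \<phi> \<psi>)"
  by (cases t) (simp add: pre_def box_comp_assoc)

lemma pre_id: "t \<in> box_pairs B X n \<Longrightarrow> pre n t (box_id n) = t"
  by (auto simp: pre_def box_pairs_def box_comp_id_right)

lemma unit_tri: "x \<in> cubes X n \<Longrightarrow> (n, box_id n, x) \<in> box_pairs B X n"
  by (simp add: box_pairs_def box_hom_id)

lemma degen_LX: "degenerate_cubes B LX n = degenerate_cubes B L0 n"
  by (simp add: degenerate_cubes_def LX_def L0_def)

lemma Lact_LC: "\<phi> \<in> box_hom B m n \<Longrightarrow> z \<in> LC n \<Longrightarrow> Lact m n \<phi> z \<in> LC m"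
  using pre_tri unfolding LC_def by (force simp: Lact_q)

lemma degen_LC: "degenerate_cubes B L0 n \<subseteq> LC n"
  unfolding degenerate_cubes_def L0_def by (auto intro!: Lact_LC degeneracy_box_hom[simplified] connection_box_hom[simplified])

lemma degen_0: "degenerate_cubes B L0 0 = {}"
  by (auto simp: degenerate_cubes_def)

lemma LX_mcSet: "LX \<in> mcSet B"
proof -
  have 1: "Lact m n \<phi> \<in> LC n \<rightarrow>\<^sub>E LC m" if "\<phi> \<in> box_hom B m n" for m n \<phi>
    unfolding PiE_def using that Lact_LC by (auto simp: Lact_def)
  have 2: "Lact n n (box_id n) z = z" if "z \<in> LC n" for n z
    using that by (auto simp: LC_def Lact_q box_hom_id pre_id)
  have 3: "Lact k m \<psi> (Lact m n \<phi> z) = Lact k n (compose (cube k) \<phi> \<psi>) z"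
    if "\<phi> \<in> box_hom B m n" "\<psi> \<in> box_hom B k m" "z \<in> LC n" for k m n \<phi> \<psi> z
    using that by (auto simp: LC_def Lact_q box_hom_comp pre_tri pre_pre)
  have 4: "eta n x \<in> LC n" if "x \<in> marked X n" for n x
    using unit_tri marked_cubes[OF X that] by (auto simp: eta_def LC_def)
  have 5: "marked X 0 = {}" using X unfolding mcSet_def by blast
  show ?thesis unfolding mcSet_def mem_Collect_eq degen_LX
    unfolding LX_def using 1 2 3 4 5 degen_LC degen_0 by (auto simp: Lact_def)
qed

lemma act_eta: assumes "\<phi> \<in> box_hom B m n" "x \<in> cubes X n"
  shows "act LX m n \<phi> (eta n x) = q m (n, \<phi>, x)"
  using assms unit_tri[OF assms(2)] by (simp add: LX_def eta_def Lact_q pre_def box_comp_id_left)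

lemma eta_hom: "eta \<in> mcHom A X (istar A LX)"
proof (rule mcHomI)
  fix m n \<phi> x assume *: "\<phi> \<in> box_hom A m n" "x \<in> cubes X n"
  note \<phi> = box_hom_mono[OF AB *(1)]
  have "((n, compose (cube m) \<phi> (box_id m), x), (m, box_id m, act X m n \<phi> x)) \<in> box_step A B X m"
    using * box_hom_id unfolding box_step_def by blast
  then have "((n, \<phi>, x), (m, box_id m, act X m n \<phi> x)) \<in> box_cong A B X m"
    unfolding box_cong_def box_comp_id_right[OF *(1)] by blast
  moreover have "(n, \<phi>, x) \<in> box_pairs B X m" using \<phi> * by (simp add: box_pairs_def)
  ultimately have "q m (n, \<phi>, x) = q m (m, box_id m, act X m n \<phi> x)" using q unit_tri[OF act_cubes[OF X *]] by blast
  then show "eta m (act X m n \<phi> x) = act (istar A LX) m n \<phi> (eta n x)"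
    using * act_eta[OF \<phi> *(2)] act_cubes[OF X *] by (simp add: eta_def)
qed (auto simp: LX_def LC_def unit_tri eta_def)

lemma LX_cubes: "z \<in> cubes LX m \<Longrightarrow> \<exists>n \<phi> x. \<phi> \<in> box_hom B m n \<and> x \<in> cubes X n \<and> z = act LX m n \<phi> (eta n x)"
  using act_eta by (force simp: LX_def LC_def box_pairs_def)

lemma universal_unique:
  assumes "h \<in> mcHom B LX W" "h' \<in> mcHom B LX W" "mcComp X h eta = mcComp X h' eta"
  shows "h = h'"
proof (rule cmap_eqI[where X=LX])
  fix m z assume "z \<in> cubes LX m"
  then obtain n \<phi> x where *: "\<phi> \<in> box_hom B m n" "x \<in> cubes X n" "z = act LX m n \<phi> (eta n x)" using LX_cubes by blast
  have "eta n x \<in> cubes LX n" using hom_cubes[OF eta_hom *(2)] by simp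
  moreover have "h n (eta n x) = h' n (eta n x)" using assms(3) comp_apply[OF *(2)] by metis
  ultimately show "h m z = h' m z" using * hom_act assms(1,2) by metis
qed (use assms hom_ext in blast)+

lemma universal_exists:
  assumes W: "W \<in> mcSet B" and g: "g \<in> mcHom A X (istar A W)"
  shows "\<exists>h\<in>mcHom B LX W. mcComp X h eta = g"
proof -
  define F where "F = (\<lambda>n (k, \<phi>, x). act W n k \<phi> (g k x))"
  define h where "h = (\<lambda>n. \<lambda>z\<in>LC n. F n (rep n z))"
  have gc: "g n x \<in> cubes W n" if "x \<in> cubes X n" for n x using hom_cubes[OF g that] by simp
  have "F n t = F n t'" if "(t, t') \<in> box_step A B X n" for n t t'
    using that unfolding box_step_def F_def
    by (auto simp: hom_act[OF g] gc act_comp[OF W box_hom_mono[OF AB]])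
  then have Fc: "F n t = F n t'" if "(t, t') \<in> box_cong A B X n" for n t t' using that by (rule box_cong_inv[where F="F n"])
  have hq: "h n (q n t) = F n t" if "t \<in> box_pairs B X n" for n t
  proof -
    have z: "q n t \<in> LC n" using that by (auto simp: LC_def)
    have "(rep n (q n t), t) \<in> box_cong A B X n" using q rep[OF z] that by blast
    then show ?thesis using z Fc by (simp add: h_def)
  qed
  have he: "h n (eta n x) = g n x" if "x \<in> cubes X n" for n x
    using that unit_tri[OF that] by (simp add: eta_def hq F_def act_id[OF W] gc)
  have Fpre: "F m (pre m t \<psi>) = act W m n \<psi> (F n t)" if "t \<in> box_pairs B X n" "\<psi> \<in> box_hom B m n" for m n t \<psi>
    using that by (auto simp: F_def pre_def box_pairs_def act_comp[OF W] gc)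
  have hact: "h m (Lact m n \<psi> z) = act W m n \<psi> (h n z)" if "\<psi> \<in> box_hom B m n" "z \<in> LC n" for m n \<psi> z
    using that unfolding LC_def by (auto simp: Lact_q hq pre_tri Fpre)
  have hc: "h n z \<in> cubes W n" if "z \<in> LC n" for n z
    using that unfolding LC_def by (auto simp: hq F_def box_pairs_def gc act_cubes[OF W])
  have hd: "h n z \<in> degenerate_cubes B W n" if "z \<in> degenerate_cubes B L0 n" for n z
    using that unfolding degenerate_cubes_def L0_def
    by (auto simp: hact[OF degeneracy_box_hom, simplified] hact[OF connection_box_hom, simplified]) (blast intro: hc)+
  have hx: "h n \<in> extensional (LC n)" for n by (simp add: h_def)
  have "h \<in> mcHom B LX W"
  proof (rule mcHomI)
    fix n z assume "z \<in> marked LX n"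
    then consider x where "x \<in> marked X n" "z = eta n x" | "z \<in> degenerate_cubes B L0 n" by (auto simp: LX_def)
    then show "h n z \<in> marked W n"
    proof cases
      case 1
      then show ?thesis using he marked_cubes[OF X] hom_marked[OF g] by auto
    next
      case 2
      then show ?thesis using hd degenerate_marked[OF W] by blast
    qed
  qed (auto simp: LX_def hact hc hx)
  moreover have "mcComp X h eta = g"
    by (rule cmap_eqI[where X=X]) (auto simp: he hom_ext[OF g])
  ultimately show ?thesis by blast
qed

end

lemma finite_cube: "finite (cube n)"
  unfolding cube_def using finite_lists_length_eq[of "UNIV :: bool set" n] by simp

lemma triple_encoding:
  assumes "infinite (UNIV :: 'u set)"
  shows "\<exists>c :: 'u box_pair \<Rightarrow> 'u. inj_on c {(k, \<phi>, x). \<exists>n. \<phi> \<in> box_hom B n k}"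
proof -
  define P where "P = (\<Union>n k. cube n \<rightarrow>\<^sub>E cube k)"
  have "countable P" unfolding P_def by (intro countable_UN countable_finite[OF finite_PiE] finite_cube countableI_type)
  then obtain p :: "(vertex \<Rightarrow> vertex) \<Rightarrow> nat" where p: "inj_on p P" using countable_def by blast
  obtain e :: "nat \<Rightarrow> 'u" where e: "inj e" using infinite_countable_subset[OF assms] by blast
  obtain d :: "'u \<times> 'u \<Rightarrow> 'u" where d: "inj d"
    using card_of_Times_same_infinite[OF assms] unfolding card_of_ordIso[symmetric] bij_betw_def UNIV_Times_UNIV
    by blast
  let ?c = "\<lambda>(k, \<phi>, x). d (e k, d (e (p \<phi>), x))"
  have "\<phi> \<in> P" if "\<phi> \<in> box_hom B n k" for \<phi> n k using box_hom_fun[OF that] by (auto simp: P_def)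
  then have pe: "\<phi> = \<phi>'" if "\<phi> \<in> box_hom B n k" "\<phi>' \<in> box_hom B n' k'" "p \<phi> = p \<phi>'" for \<phi> \<phi>' n n' k k'
    using inj_onD[OF p] that by blast
  have "inj_on ?c {(k, \<phi>, x). \<exists>n. \<phi> \<in> box_hom B n k}"
  proof (rule inj_onI)
    fix s t assume st: "s \<in> {(k, \<phi>, x). \<exists>n. \<phi> \<in> box_hom B n k}"
      "t \<in> {(k, \<phi>, x). \<exists>n. \<phi> \<in> box_hom B n k}" "?c s = ?c t"
    obtain k \<phi> x k' \<phi>' x' where *: "s = (k, \<phi>, x)" "t = (k', \<phi>', x')" by (metis prod_cases3)
    then have "k = k'" "p \<phi> = p \<phi>'" "x = x'" using st(3) by (auto dest!: injD[OF d] injD[OF e])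
    moreover have "\<phi> = \<phi>'" using pe \<open>p \<phi> = p \<phi>'\<close> st(1,2) * by blast
    ultimately show "s = t" using * by simp
  qed
  then show ?thesis by blast
qed

lemma box_adjunction_exists:
  assumes AB: "A \<subseteq> B" and inf: "infinite (UNIV :: 'u set)"
  shows "\<exists>(L :: 'u mcset \<Rightarrow> 'u mcset) Lm \<eta> \<epsilon>. box_adjunction A B L Lm \<eta> \<epsilon>"
proof -
  obtain c :: "'u box_pair \<Rightarrow> 'u" where c: "inj_on c {(k, \<phi>, x). \<exists>n. \<phi> \<in> box_hom B n k}" using triple_encoding[OF inf] by blast
  define r where "r = (\<lambda>(X :: 'u mcset) n t. SOME t'. t' \<in> box_pairs B X n \<and> (t, t') \<in> box_cong A B X n)"
  define q where "q = (\<lambda>X n t. c (r X n t))"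
  have r: "r X n t \<in> box_pairs B X n" "(t, r X n t) \<in> box_cong A B X n" if "t \<in> box_pairs B X n" for X n t
    using someI[of "\<lambda>t'. t' \<in> box_pairs B X n \<and> (t, t') \<in> box_cong A B X n" t] that unfolding r_def by (auto simp: box_cong_def)
  have tr: "(t, v) \<in> box_cong A B X n" if "(t, u) \<in> box_cong A B X n" "(u, v) \<in> box_cong A B X n" for t u v X n
    using that unfolding box_cong_def by (rule rtrancl_trans)
  have rr: "r X n t = r X n t'" if "(t, t') \<in> box_cong A B X n" for t t' X n
  proof -
    have "(t, u) \<in> box_cong A B X n \<longleftrightarrow> (t', u) \<in> box_cong A B X n" for u using tr box_cong_sym that by blast
    then show ?thesis unfolding r_def by simp
  qed
  have q: "q X n t = q X n t' \<longleftrightarrow> (t, t') \<in> box_cong A B X n" if "t \<in> box_pairs B X n" "t' \<in> box_pairs B X n" for X n t t'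
  proof
    assume "q X n t = q X n t'"
    then have "r X n t = r X n t'" using r(1)[OF that(1)] r(1)[OF that(2)] unfolding q_def box_pairs_def
      by (intro inj_onD[OF c]) auto
    then show "(t, t') \<in> box_cong A B X n" using r(2)[OF that(1)] r(2)[OF that(2)] tr box_cong_sym by metis
  qed (simp add: q_def rr)
  have fb: "free_box A B X (q X)" if "X \<in> mcSet A" for X
    by unfold_locales (use AB that q in auto)
  show ?thesis
    using adjunction_from_universal[OF AB, of "\<lambda>X. free_box.LX B X (q X)" "\<lambda>X. free_box.eta X (q X)"]
      free_box.LX_mcSet[OF fb] free_box.eta_hom[OF fb] free_box.universal_exists[OF fb] free_box.universal_unique[OF fb]
    by blast
qed

end

theory Submission
  imports Defs
begin

text \<open>
  The point which is not formal is that \<open>i\<^sub>!X\<close> is generated by the image of \<open>\<eta>\<^sub>X\<close>: the subobject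
  generated by this image receives a transpose of \<open>\<eta>\<^sub>X\<close>, which is a section of its inclusion into
  \<open>i\<^sub>!X\<close>. Given a strong connection structure \<open>\<Gamma>\<close> on \<open>X\<close>, the cubes \<open>x(\<phi>)\<close> extend \<open>X\<close> to an object
  \<open>X'\<close> of \<open>cSet\<^sub>B\<^sup>+\<close> with \<open>i\<^sup>*X' = X\<close>, and the generation of \<open>i\<^sub>!X\<close> makes \<open>\<Gamma>\<close> a map \<open>i\<^sub>!X \<rightarrow> X'\<close> over
  \<open>Box B\<close>; as \<open>\<Gamma>\<eta> = id\<close>, it is the counit at \<open>X'\<close>. Conversely, the structure on \<open>X\<close> coming from
  \<open>\<alpha> : i\<^sup>*X' \<cong> X\<close> is \<open>\<alpha> \<circ> \<epsilon>\<^bsub>X'\<^esub> \<circ> i\<^sub>!\<alpha>\<^sup>-\<^sup>1\<close>, for which \<open>x(\<phi>) = \<alpha>((\<alpha>\<^sup>-\<^sup>1x)\<phi>)\<close>.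
\<close>

section \<open>Subobjects, and the object over \<open>Box B\<close> built from a connection
  structure\<close>

definition mcSub :: "bool set \<Rightarrow> 'u mcset \<Rightarrow> (nat \<Rightarrow> 'u set) \<Rightarrow> 'u mcset" where
  "mcSub B V S = \<lparr>cubes = S,
     act = (\<lambda>m n \<phi>. if \<phi> \<in> box_hom B m n then restrict (act V m n \<phi>) (S n) else (\<lambda>_. undefined)),
     marked = (\<lambda>n. marked V n \<inter> S n)\<rparr>"

lemma mcSub_simps [simp]:
  "cubes (mcSub B V S) = S"
  "marked (mcSub B V S) n = marked V n \<inter> S n"
  "\<phi> \<in> box_hom B m n \<Longrightarrow> act (mcSub B V S) m n \<phi> = restrict (act V m n \<phi>) (S n)"
  by (simp_all add: mcSub_def)

text \<open>A degenerate cube of the subobject is degenerate in \<open>V\<close>, hence marked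
  there, and it lies in \<open>S n\<close> by closure. Markings are inherited from \<open>V\<close>,
  so corestricting a map to the subobject loses none.\<close>

lemma mcSub_mcSet:
  assumes V: "V \<in> mcSet B" and S: "\<And>n. S n \<subseteq> cubes V n"
    and closed: "\<And>m n \<phi> x. \<phi> \<in> box_hom B m n \<Longrightarrow> x \<in> S n \<Longrightarrow> act V m n \<phi> x \<in> S m"
  shows "mcSub B V S \<in> mcSet B"
proof -
  have SV: "x \<in> cubes V n" if "x \<in> S n" for x n using S that by blast
  have "degenerate_cubes B (mcSub B V S) n \<subseteq> degenerate_cubes B V n \<inter> S n" for n
    unfolding degenerate_cubes_def using S
    by (auto simp: degeneracy_box_hom[simplified] connection_box_hom[simplified] closed) blast+
  moreover have "degenerate_cubes B V n \<subseteq> marked V n" for n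
    using degenerate_marked[OF V] by blast
  ultimately have degenerate: "degenerate_cubes B (mcSub B V S) n \<subseteq> marked (mcSub B V S) n" for n
    by fastforce
  have outside: "act (mcSub B V S) m n \<phi> = (\<lambda>_. undefined)" if "\<phi> \<notin> box_hom B m n" for m n \<phi>
    using that by (simp add: mcSub_def)
  have "marked V 0 = {}" using V unfolding mcSet_def by blast
  then show ?thesis unfolding mcSet_def using degenerate outside
    by (auto simp: closed act_id[OF V SV] act_comp[OF V _ _ SV] box_hom_id box_hom_comp)
qed

text \<open>Keeping the cubes and markings of \<open>X\<close> makes the later identity
  \<open>istar A X' = X\<close> an equality rather than an isomorphism. The values off
  \<open>box_hom B\<close> and off the cubes are those that \<open>mcSet\<close> prescribes.\<close>

definition conn_mcset :: "bool set \<Rightarrow> 'u mcset \<Rightarrow> 'u cmap \<Rightarrow> 'u mcset \<Rightarrow> 'u cmap \<Rightarrow> 'u mcset" where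
  "conn_mcset B LX \<eta>X X \<Gamma> = \<lparr>cubes = cubes X,
     act = (\<lambda>m n \<phi>. if \<phi> \<in> box_hom B m n then restrict (conn_act LX \<eta>X \<Gamma> m n \<phi>) (cubes X n)
       else (\<lambda>_. undefined)),
     marked = marked X\<rparr>"

lemma conn_mcset_simps [simp]:
  "cubes (conn_mcset B LX \<eta>X X \<Gamma>) = cubes X"
  "marked (conn_mcset B LX \<eta>X X \<Gamma>) = marked X"
  "\<phi> \<in> box_hom B m n \<Longrightarrow> x \<in> cubes X n \<Longrightarrow>
     act (conn_mcset B LX \<eta>X X \<Gamma>) m n \<phi> x = conn_act LX \<eta>X \<Gamma> m n \<phi> x"
  by (simp_all add: conn_mcset_def)

section \<open>Isomorphisms and identity maps\<close>

lemma mcIso_id: "X \<in> mcSet A \<Longrightarrow> mcId X \<in> mcIso A X X"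
  unfolding mcIso_def using hom_id[of X A] by (auto intro!: bexI[of _ "mcId X"] cmap_eqI[where X=X])

lemma mcIsoE:
  assumes "\<alpha> \<in> mcIso A X Y"
  obtains \<alpha>' where "\<alpha> \<in> mcHom A X Y" "\<alpha>' \<in> mcHom A Y X"
    "\<And>n x. x \<in> cubes X n \<Longrightarrow> \<alpha>' n (\<alpha> n x) = x" "\<And>n y. y \<in> cubes Y n \<Longrightarrow> \<alpha> n (\<alpha>' n y) = y"
proof -
  obtain \<alpha>' where *: "\<alpha> \<in> mcHom A X Y" "\<alpha>' \<in> mcHom A Y X"
    "mcComp X \<alpha>' \<alpha> = mcId X" "mcComp Y \<alpha> \<alpha>' = mcId Y"
    using assms unfolding mcIso_def by blast
  have "\<alpha>' n (\<alpha> n x) = x" if "x \<in> cubes X n" for n x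
    using arg_cong[OF *(3), of "\<lambda>h. h n x"] that by simp
  moreover have "\<alpha> n (\<alpha>' n y) = y" if "y \<in> cubes Y n" for n y
    using arg_cong[OF *(4), of "\<lambda>h. h n y"] that by simp
  ultimately show ?thesis using that *(1,2) by blast
qed

lemma mcHom_id_comp:
  assumes "f \<in> mcHom A X Y"
  shows "mcComp X (mcId Y) f = f" "mcComp X f (mcId X) = f"
  using hom_cubes[OF assms] by (auto intro!: cmap_eqI[where X=X] hom_ext[OF assms])

section \<open>The adjunction on single cubes, and generation of \<open>L X\<close> by the
  unit\<close>

locale box_inclusion_adjunction = box_adjunction A B L Lm \<eta> \<epsilon>
  for A B :: "bool set"
    and L :: "'u mcset \<Rightarrow> 'u mcset"
    and Lm :: "'u mcset \<Rightarrow> 'u mcset \<Rightarrow> 'u cmap \<Rightarrow> 'u cmap"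
    and \<eta> \<epsilon> :: "'u mcset \<Rightarrow> 'u cmap" +
  assumes AB: "A \<subseteq> B"
begin

lemma unit_cubes: "X \<in> mcSet A \<Longrightarrow> x \<in> cubes X n \<Longrightarrow> \<eta> X n x \<in> cubes (L X) n"
  using hom_cubes[OF unit_hom] by fastforce

lemma Lm_unit:
  "X \<in> mcSet A \<Longrightarrow> Y \<in> mcSet A \<Longrightarrow> f \<in> mcHom A X Y \<Longrightarrow> x \<in> cubes X n \<Longrightarrow>
     Lm X Y f n (\<eta> X n x) = \<eta> Y n (f n x)"
  using arg_cong[OF unit_natural, of X Y f "\<lambda>h. h n x"] by simp

lemma Lm_comp_apply:
  "X \<in> mcSet A \<Longrightarrow> Y \<in> mcSet A \<Longrightarrow> Z \<in> mcSet A \<Longrightarrow> f \<in> mcHom A X Y \<Longrightarrow> g \<in> mcHom A Y Z \<Longrightarrow>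
     z \<in> cubes (L X) n \<Longrightarrow> Lm Y Z g n (Lm X Y f n z) = Lm X Z (mcComp X g f) n z"
  using L_comp[of X Y Z f g] by simp

lemma counit_unit:
  "V \<in> mcSet B \<Longrightarrow> x \<in> cubes V n \<Longrightarrow> \<epsilon> V n (\<eta> (istar A V) n x) = x"
  using arg_cong[OF triangle_istar, of V "\<lambda>h. h n x"] by simp

lemma counit_natural_apply:
  "V \<in> mcSet B \<Longrightarrow> W \<in> mcSet B \<Longrightarrow> g \<in> mcHom B V W \<Longrightarrow> z \<in> cubes (L (istar A V)) n \<Longrightarrow>
     \<epsilon> W n (Lm (istar A V) (istar A W) g n z) = g n (\<epsilon> V n z)"
  using arg_cong[OF counit_natural, of V W g "\<lambda>h. h n z"] by simp

text \<open>The triangle identity writes \<open>z\<close> as the counit at \<open>L X\<close>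
  applied to \<open>?z\<close>; naturality of the counit moves \<open>h\<close> inside, and
  functoriality of \<open>L\<close> merges the two maps. Hence \<open>h\<close> depends only on its
  composite with the unit.\<close>

lemma hom_as_transpose:
  assumes X: "X \<in> mcSet A" and W: "W \<in> mcSet B" and h: "h \<in> mcHom B (L X) W"
    and z: "z \<in> cubes (L X) n"
  shows "h n z = \<epsilon> W n (Lm X (istar A W) (mcComp X h (\<eta> X)) n z)"
proof -
  note LX = L_obj[OF X]
  note st = istar_mcSet[OF AB]
  note \<eta>X = unit_hom[OF X]
  let ?z = "Lm X (istar A (L X)) (\<eta> X) n z"
  have c: "?z \<in> cubes (L (istar A (L X))) n"
    using hom_cubes[OF L_hom[OF X st[OF LX] \<eta>X] z] .
  have "h n z = h n (\<epsilon> (L X) n ?z)"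
    using arg_cong[OF triangle_L[OF X], of "\<lambda>h. h n z"] z by simp
  also have "\<dots> = \<epsilon> W n (Lm (istar A (L X)) (istar A W) h n ?z)"
    using counit_natural_apply[OF LX W h c] by simp
  also have "\<dots> = \<epsilon> W n (Lm X (istar A W) (mcComp X h (\<eta> X)) n z)"
    using Lm_comp_apply[OF X st[OF LX] st[OF W] \<eta>X istar_mcHom[OF AB h] z] by simp
  finally show ?thesis .
qed

lemma hom_eqI:
  assumes X: "X \<in> mcSet A" and W: "W \<in> mcSet B"
    and h: "h \<in> mcHom B (L X) W" and h': "h' \<in> mcHom B (L X) W"
    and eq: "\<And>n x. x \<in> cubes X n \<Longrightarrow> h n (\<eta> X n x) = h' n (\<eta> X n x)"
  shows "h = h'"
proof -
  have "mcComp X h (\<eta> X) = mcComp X h' (\<eta> X)"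
    by (rule cmap_eqI[where X=X]) (auto simp: eq)
  then have "h n z = h' n z" if "z \<in> cubes (L X) n" for n z
    using hom_as_transpose[OF X W h that] hom_as_transpose[OF X W h' that] by simp
  then show ?thesis using hom_ext[OF h] hom_ext[OF h'] by (rule cmap_eqI)
qed

text \<open>\<open>L\<close> is an arbitrary left adjoint, so its cubes cannot be read off a
  construction; the adjunction alone has to show that there are no cubes beyond those generated by
  the unit.\<close>

lemma cubes_L_generated:
  assumes X: "X \<in> mcSet A" and z: "z \<in> cubes (L X) m"
  shows "\<exists>n \<phi> x. \<phi> \<in> box_hom B m n \<and> x \<in> cubes X n \<and> z = act (L X) m n \<phi> (\<eta> X n x)"
proof -
  note LX = L_obj[OF X]
  define S where "S = (\<lambda>m. {act (L X) m n \<phi> (\<eta> X n x) | n \<phi> x. \<phi> \<in> box_hom B m n \<and> x \<in> cubes X n})"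
  define V where "V = mcSub B (L X) S"
  have S_sub: "S n \<subseteq> cubes (L X) n" for n
    unfolding S_def using act_cubes[OF LX] unit_cubes[OF X] by blast
  have closed: "act (L X) m n \<phi> z \<in> S m" if "\<phi> \<in> box_hom B m n" "z \<in> S n" for m n \<phi> z
    using that unfolding S_def
    by (auto simp: act_comp[OF LX] unit_cubes[OF X]) (use box_hom_comp in blast)
  have V: "V \<in> mcSet B" unfolding V_def using mcSub_mcSet[OF LX S_sub closed] .
  have unit_S: "\<eta> X n x \<in> S n" if "x \<in> cubes X n" for n x
    using act_id[OF LX unit_cubes[OF X that]] that box_hom_id[of n B]
    unfolding S_def by (metis (mono_tags, lifting) mem_Collect_eq)
  \<comment> \<open>The unit takes values in \<open>S\<close>, so the same functions form a map into
    \<open>istar A V\<close>; its transpose is \<open>h\<close> below.\<close>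
  have g: "\<eta> X \<in> mcHom A X (istar A V)"
    by (rule mcHomI)
      (use box_hom_mono[OF AB] hom_act[OF unit_hom[OF X]] hom_marked[OF unit_hom[OF X]]
         marked_cubes[OF X] unit_S in
       \<open>auto simp: V_def hom_ext[OF unit_hom[OF X]]\<close>)
  define h where "h = mcComp (L X) (\<epsilon> V) (Lm X (istar A V) (\<eta> X))"
  note st = istar_mcSet[OF AB]
  have h: "h \<in> mcHom B (L X) V"
    unfolding h_def by (rule hom_comp[OF LX L_hom[OF X st[OF V] g] counit_hom[OF V]])
  have hS: "h n z \<in> S n" if "z \<in> cubes (L X) n" for n z
    using hom_cubes[OF h that] by (simp add: V_def)
  \<comment> \<open>Maps do not record their codomain: read with codomain \<open>L X\<close>,
    \<open>h\<close> is already its composite with the inclusion of \<open>V\<close>.\<close>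
  have h': "h \<in> mcHom B (L X) (L X)"
    using hS S_sub hom_act[OF h] hom_marked[OF h] hom_ext[OF h]
    by (intro mcHomI) (auto simp: V_def)
  have h_unit: "h n (\<eta> X n x) = \<eta> X n x" if "x \<in> cubes X n" for n x
  proof -
    have "\<eta> X n x \<in> cubes V n" using unit_S[OF that] by (simp add: V_def)
    then show ?thesis
      using that by (simp add: h_def unit_cubes[OF X] Lm_unit[OF X st[OF V] g] counit_unit[OF V])
  qed
  \<comment> \<open>Both maps fix every \<open>\<eta> X n x\<close>, so they agree; as the values of
    \<open>h\<close> lie in \<open>S\<close>, so does every cube.\<close>
  have "h = mcId (L X)"
    by (rule hom_eqI[OF X LX h' hom_id[OF LX]]) (simp add: h_unit unit_cubes[OF X])
  then have "z \<in> S m" using hS[OF z] z by simp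
  then show ?thesis unfolding S_def by blast
qed

section \<open>Strong connection structures as objects over \<open>Box B\<close>, and their
  transport along isomorphisms\<close>

lemma conn_mcset:
  assumes X: "X \<in> mcSet A" and \<Gamma>: "strong_connection_structure A B (L X) (\<eta> X) X \<Gamma>"
  defines "X' \<equiv> conn_mcset B (L X) (\<eta> X) X \<Gamma>"
  shows "X' \<in> mcSet B" "istar A X' = X" "\<epsilon> X' = \<Gamma>"
proof -
  note LX = L_obj[OF X]
  note \<eta>X = unit_hom[OF X]
  let ?c = "conn_act (L X) (\<eta> X) \<Gamma>"
  have hom: "\<Gamma> \<in> mcHom A (istar A (L X)) X" and "mcComp X \<Gamma> (\<eta> X) = mcId X"
    using \<Gamma> unfolding strong_connection_structure_def weak_connection_structure_def by auto
  then have unit: "\<Gamma> n (\<eta> X n x) = x" if "x \<in> cubes X n" for n x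
    using that by (metis comp_apply id_apply')
  have comp: "?c k m \<psi> (?c m n \<phi> x) = ?c k n (compose (cube k) \<phi> \<psi>) x"
    if "\<phi> \<in> box_hom B m n" "\<psi> \<in> box_hom B k m" "x \<in> cubes X n" for k m n \<phi> \<psi> x
    using \<Gamma> that unfolding strong_connection_structure_def by blast
  have cubes: "?c m n \<phi> x \<in> cubes X m" if "\<phi> \<in> box_hom B m n" "x \<in> cubes X n" for m n \<phi> x
    using hom_cubes[OF hom] act_cubes[OF LX that(1) unit_cubes[OF X that(2)]]
    by (simp add: conn_act_def)
  have id: "?c n n (box_id n) x = x" if "x \<in> cubes X n" for n x
    using that by (simp add: conn_act_def act_id[OF LX] unit_cubes[OF X] unit)
  \<comment> \<open>On \<open>Box A\<close> the unit commutes with \<phi>, and \<Gamma> is a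
    retraction of the unit, so the new structure maps extend the old ones.\<close>
  have restrict: "?c m n \<phi> x = act X m n \<phi> x" if "\<phi> \<in> box_hom A m n" "x \<in> cubes X n" for m n \<phi> x
    using that hom_act[OF \<eta>X that] unit[OF act_cubes[OF X that]] by (simp add: conn_act_def)
  \<comment> \<open>A degenerate cube of \<open>X'\<close> is the value of \<Gamma> at a degenerate
    cube of \<open>L X\<close>, also for connections in \<open>B\<close> but not in
    \<open>A\<close>. The latter cube is marked, and \<Gamma> preserves markings.\<close>
  have degenerate: "degenerate_cubes B X' n \<subseteq> marked X' n" for n
  proof
    fix x assume "x \<in> degenerate_cubes B X' n"
    then obtain \<phi> y where "\<phi> \<in> box_hom B n (n - 1)" "y \<in> cubes X (n - 1)" "x = act X' n (n - 1) \<phi> y"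
      "act (L X) n (n - 1) \<phi> (\<eta> X (n - 1) y) \<in> degenerate_cubes B (L X) n"
      unfolding degenerate_cubes_def X'_def
      using degeneracy_box_hom[of _ n B] connection_box_hom[of _ B _ n] unit_cubes[OF X, of _ "n - 1"]
      by auto blast+
    then show "x \<in> marked X' n"
      using degenerate_marked[OF LX] hom_marked[OF hom] by (simp add: X'_def conn_act_def)
  qed
  have "act X' m n \<phi> \<in> cubes X n \<rightarrow>\<^sub>E cubes X m" if "\<phi> \<in> box_hom B m n" for m n \<phi>
    using that cubes by (auto simp: X'_def conn_mcset_def)
  moreover have "act X' m n \<phi> = (\<lambda>_. undefined)" if "\<phi> \<notin> box_hom B m n" for m n \<phi>
    using that by (simp add: X'_def conn_mcset_def)
  moreover have "marked X 0 = {}" "marked X n \<subseteq> cubes X n" for n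
    using X unfolding mcSet_def by blast+
  ultimately show X': "X' \<in> mcSet B"
    unfolding mcSet_def using degenerate
    by (auto simp: X'_def id comp cubes box_hom_id box_hom_comp)
  \<comment> \<open>Equality of records asks for agreement also off \<open>cubes X n\<close> and off
    \<open>box_hom A m n\<close>, where both sides are \<open>undefined\<close>.\<close>
  have "act (istar A X') m n \<phi> = act X m n \<phi>" for m n \<phi>
  proof (cases "\<phi> \<in> box_hom A m n")
    case True
    have "act X m n \<phi> \<in> extensional (cubes X n)"
      using X True unfolding mcSet_def PiE_def by blast
    then show ?thesis
      using True box_hom_mono[OF AB True] restrict[OF True]
      by (auto simp: X'_def conn_mcset_def fun_eq_iff extensional_def)
  next
    case False
    then show ?thesis using X by (auto simp: istar_def mcSet_def)
  qed
  then show st: "istar A X' = X"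
    by (intro mcset.equality ext) (simp_all add: X'_def)
  \<comment> \<open>\<Gamma> is given only as a map over \<open>Box A\<close>. On a generator
    \<open>act (L X) m n \<phi> (\<eta> X n x)\<close>, compatibility with \<psi> in
    \<open>Box B\<close> is the equation \<open>comp\<close>, that is, strength.\<close>
  have "\<Gamma> \<in> mcHom B (L X) X'"
  proof (rule mcHomI)
    fix k m \<psi> z assume \<psi>: "\<psi> \<in> box_hom B k m" and "z \<in> cubes (L X) m"
    then obtain n \<phi> x where *: "\<phi> \<in> box_hom B m n" "x \<in> cubes X n" "z = act (L X) m n \<phi> (\<eta> X n x)"
      using cubes_L_generated[OF X] by blast
    have "\<Gamma> k (act (L X) k m \<psi> z) = ?c k n (compose (cube k) \<phi> \<psi>) x"
      using * \<psi> by (simp add: conn_act_def act_comp[OF LX] unit_cubes[OF X])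
    also have "\<dots> = ?c k m \<psi> (\<Gamma> m z)"
      using comp[OF *(1) \<psi> *(2)] *(3) by (simp add: conn_act_def)
    also have "\<dots> = act X' k m \<psi> (\<Gamma> m z)"
      using \<psi> cubes[OF *(1,2)] *(3) by (simp add: X'_def conn_act_def)
    finally show "\<Gamma> k (act (L X) k m \<psi> z) = act X' k m \<psi> (\<Gamma> m z)" .
  qed (use hom_ext[OF hom] hom_cubes[OF hom] hom_marked[OF hom] in \<open>auto simp: X'_def\<close>)
  \<comment> \<open>Since \<open>istar A X' = X\<close>, both maps go from \<open>L X\<close> to
    \<open>X'\<close>, and both send \<open>\<eta> X n x\<close> to \<open>x\<close>; a map out of
    \<open>L X\<close> is determined by these values.\<close>
  then show "\<epsilon> X' = \<Gamma>"
    using counit_hom[OF X'] counit_unit[OF X'] unit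
    by (intro hom_eqI[OF X X']) (auto simp: st, simp add: X'_def)
qed

text \<open>The structure is the counit at \<open>V\<close> conjugated by \<alpha>. The last clause
  allows equations on \<open>L X\<close> to be checked on cubes coming from
  \<open>L (istar A V)\<close>.\<close>

lemma transfer_strong_structure:
  assumes X: "X \<in> mcSet A" and V: "V \<in> mcSet B" and \<alpha>: "\<alpha> \<in> mcIso A (istar A V) X"
  obtains \<Gamma> where "strong_connection_structure A B (L X) (\<eta> X) X \<Gamma>"
    "\<And>n z. z \<in> cubes (L (istar A V)) n \<Longrightarrow> \<Gamma> n (Lm (istar A V) X \<alpha> n z) = \<alpha> n (\<epsilon> V n z)"
    "\<And>n z. z \<in> cubes (L X) n \<Longrightarrow> \<exists>w\<in>cubes (L (istar A V)) n. z = Lm (istar A V) X \<alpha> n w"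
proof -
  note LX = L_obj[OF X] and st = istar_mcSet[OF AB V]
  obtain \<alpha>' where \<alpha>: "\<alpha> \<in> mcHom A (istar A V) X" and \<alpha>': "\<alpha>' \<in> mcHom A X (istar A V)"
    and inv: "\<And>n x. x \<in> cubes V n \<Longrightarrow> \<alpha>' n (\<alpha> n x) = x" "\<And>n x. x \<in> cubes X n \<Longrightarrow> \<alpha> n (\<alpha>' n x) = x"
    using \<alpha> by (rule mcIsoE) simp
  let ?L\<alpha>' = "Lm X (istar A V) \<alpha>'"
  define \<Gamma> where "\<Gamma> = mcComp (L X) \<alpha> (mcComp (L X) (\<epsilon> V) ?L\<alpha>')"
  have L\<alpha>': "?L\<alpha>' \<in> mcHom B (L X) (L (istar A V))" by (rule L_hom[OF X st \<alpha>'])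
  \<comment> \<open>The transpose of the inverse of \<alpha> is a map over \<open>Box B\<close>;
    composing with \<alpha> leaves a map over \<open>Box A\<close> only, as \<open>X\<close> has no
    further structure maps.\<close>
  have transpose: "mcComp (L X) (\<epsilon> V) ?L\<alpha>' \<in> mcHom B (L X) V"
    using hom_comp[OF LX L\<alpha>' counit_hom[OF V]] .
  have hom: "\<Gamma> \<in> mcHom A (istar A (L X)) X"
    unfolding \<Gamma>_def
    using hom_comp[OF istar_mcSet[OF AB LX] istar_mcHom[OF AB transpose] \<alpha>]
    by (simp add: mcComp_def)
  have unit: "\<Gamma> n (\<eta> X n x) = x" if "x \<in> cubes X n" for n x
    using that hom_cubes[OF \<alpha>' that]
    by (simp add: \<Gamma>_def unit_cubes[OF X] Lm_unit[OF X st \<alpha>'] counit_unit[OF V] inv)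
  \<comment> \<open>The transpose commutes with \<phi> and sends \<open>\<eta> X n x\<close> to
    \<open>\<alpha>' n x\<close>. When this formula is iterated, the inner \<alpha> is cancelled by
    \<open>\<alpha>'\<close>, so strength reduces to functoriality of the structure maps of
    \<open>V\<close>.\<close>
  have c: "conn_act (L X) (\<eta> X) \<Gamma> m n \<phi> x = \<alpha> m (act V m n \<phi> (\<alpha>' n x))"
    if "\<phi> \<in> box_hom B m n" "x \<in> cubes X n" for m n \<phi> x
    using that hom_cubes[OF \<alpha>' that(2)] hom_act[OF transpose that(1) unit_cubes[OF X that(2)]]
    by (simp add: conn_act_def \<Gamma>_def unit_cubes[OF X] act_cubes[OF LX] Lm_unit[OF X st \<alpha>'] counit_unit[OF V])
  have "strong_connection_structure A B (L X) (\<eta> X) X \<Gamma>"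
    unfolding strong_connection_structure_def weak_connection_structure_def
  proof (intro conjI allI ballI)
    show "\<Gamma> \<in> mcHom A (istar A (L X)) X" by (rule hom)
    show "mcComp X \<Gamma> (\<eta> X) = mcId X" by (rule cmap_eqI[where X=X]) (auto simp: unit)
    fix k m n \<phi> \<psi> x assume *: "\<phi> \<in> box_hom B m n" "\<psi> \<in> box_hom B k m" "x \<in> cubes X n"
    have x: "\<alpha>' n x \<in> cubes V n" using hom_cubes[OF \<alpha>' *(3)] by simp
    have "\<alpha> m (act V m n \<phi> (\<alpha>' n x)) \<in> cubes X m"
      using hom_cubes[OF \<alpha>] act_cubes[OF V *(1) x] by simp
    then show "conn_act (L X) (\<eta> X) \<Gamma> k m \<psi> (conn_act (L X) (\<eta> X) \<Gamma> m n \<phi> x) =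
        conn_act (L X) (\<eta> X) \<Gamma> k n (compose (cube k) \<phi> \<psi>) x"
      using * x by (simp add: c box_hom_comp inv act_cubes[OF V] act_comp[OF V])
  qed
  moreover have "\<Gamma> n (Lm (istar A V) X \<alpha> n z) = \<alpha> n (\<epsilon> V n z)"
    if z: "z \<in> cubes (L (istar A V)) n" for n z
  proof -
    have "mcComp (istar A V) \<alpha>' \<alpha> = mcId (istar A V)"
      by (rule cmap_eqI[where X="istar A V"], simp add: inv, (rule comp_ext id_ext)+)
    then have "?L\<alpha>' n (Lm (istar A V) X \<alpha> n z) = z"
      using z by (simp add: Lm_comp_apply[OF st X st \<alpha> \<alpha>'] L_id[OF st])
    then show ?thesis
      using hom_cubes[OF L_hom[OF st X \<alpha>] z] by (simp add: \<Gamma>_def)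
  qed
  moreover have "\<exists>w\<in>cubes (L (istar A V)) n. z = Lm (istar A V) X \<alpha> n w"
    if z: "z \<in> cubes (L X) n" for n z
  proof -
    have "mcComp X \<alpha> \<alpha>' = mcId X"
      by (rule cmap_eqI[where X=X]) (auto simp: inv)
    then have "Lm (istar A V) X \<alpha> n (?L\<alpha>' n z) = z"
      using z by (simp add: Lm_comp_apply[OF X st X \<alpha>' \<alpha>] L_id[OF X])
    then show ?thesis using hom_cubes[OF L\<alpha>' z] by force
  qed
  ultimately show ?thesis using that by blast
qed

section \<open>Lifting a compatible map, and transporting structures along an isomorphism of
  maps\<close>

lemma strict_lift:
  assumes X: "X \<in> mcSet A" and Y: "Y \<in> mcSet A" and f: "f \<in> mcHom A X Y"
    and \<Gamma>: "compatible_strong_structures A B L Lm \<eta> X Y f \<Gamma>X \<Gamma>Y"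
  shows "\<exists>X'\<in>mcSet B. \<exists>Y'\<in>mcSet B. \<exists>f'\<in>mcHom B X' Y'. \<exists>\<alpha> \<beta>.
    arrow_iso A (istar A X') (istar A Y') f' X Y f \<alpha> \<beta> \<and>
    counit_cube A L Lm \<epsilon> X' Y' f' X Y f \<Gamma>X \<Gamma>Y \<alpha> \<beta>"
proof -
  have sX: "strong_connection_structure A B (L X) (\<eta> X) X \<Gamma>X"
    and sY: "strong_connection_structure A B (L Y) (\<eta> Y) Y \<Gamma>Y"
    and comm: "mcComp (L X) f \<Gamma>X = mcComp (L X) \<Gamma>Y (Lm X Y f)"
    using \<Gamma> unfolding compatible_strong_structures_def by auto
  \<comment> \<open>These objects have the cubes of \<open>X\<close> and \<open>Y\<close>
    themselves, so \<open>f\<close> can serve as its own lift, with identities as \<alpha> and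
    \<beta>.\<close>
  define X' where "X' = conn_mcset B (L X) (\<eta> X) X \<Gamma>X"
  define Y' where "Y' = conn_mcset B (L Y) (\<eta> Y) Y \<Gamma>Y"
  note X' = conn_mcset[OF X sX, folded X'_def] and Y' = conn_mcset[OF Y sY, folded Y'_def]
  note LX = L_obj[OF X] and Lf = L_hom[OF X Y f]
  have comm': "f n (\<Gamma>X n z) = \<Gamma>Y n (Lm X Y f n z)" if "z \<in> cubes (L X) n" for n z
    using arg_cong[OF comm, of "\<lambda>h. h n z"] that by simp
  have \<Gamma>X: "\<Gamma>X \<in> mcHom B (L X) X'" and \<Gamma>Y: "\<Gamma>Y \<in> mcHom B (L Y) Y'"
    using counit_hom[OF X'(1)] counit_hom[OF Y'(1)] unfolding X'(2,3) Y'(2,3) .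
  have id_eq: "mcId X = mcId X'" "mcId Y = mcId Y'"
    by (simp_all add: mcId_def X'_def Y'_def)
  \<comment> \<open>By compatibility, \<open>f\<close> after \<open>\<Gamma>X\<close> is
    \<open>\<Gamma>Y\<close> after \<open>Lm X Y f\<close>; the latter commutes with \<phi> and
    sends \<open>\<eta> X n x\<close> to \<open>\<eta> Y n (f n x)\<close>. So \<open>f\<close>
    takes x(\<phi>) to (f x)(\<phi>).\<close>
  have "f \<in> mcHom B X' Y'"
  proof (rule mcHomI)
    fix m n \<phi> x assume \<phi>: "\<phi> \<in> box_hom B m n" and "x \<in> cubes X' n"
    then have x: "x \<in> cubes X n" by (simp add: X'_def)
    show "f m (act X' m n \<phi> x) = act Y' m n \<phi> (f n x)"
      using \<phi> x hom_cubes[OF f x]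
      by (simp add: X'_def Y'_def conn_act_def comm' act_cubes[OF LX] unit_cubes[OF X]
          hom_act[OF Lf] Lm_unit[OF X Y f])
  qed (use hom_ext[OF f] hom_cubes[OF f] hom_marked[OF f] in \<open>auto simp: X'_def Y'_def\<close>)
  moreover have "arrow_iso A (istar A X') (istar A Y') f X Y f (mcId X) (mcId Y)"
    unfolding arrow_iso_def X'(2) Y'(2)
    by (simp add: mcIso_id X Y mcHom_id_comp[OF f])
  \<comment> \<open>The connecting edges are identities and the counits are \<open>\<Gamma>X\<close>
    and \<open>\<Gamma>Y\<close>, so the faces reduce to unit laws and \<open>comm\<close>.\<close>
  moreover have "counit_cube A L Lm \<epsilon> X' Y' f X Y f \<Gamma>X \<Gamma>Y (mcId X) (mcId Y)"
    unfolding counit_cube_def Let_def X'(2,3) Y'(2,3) L_id[OF X] L_id[OF Y]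
    using mcHom_id_comp[OF \<Gamma>X] mcHom_id_comp[OF \<Gamma>Y] mcHom_id_comp[OF Lf] mcHom_id_comp[OF f]
    by (simp add: comm id_eq)
  ultimately show ?thesis using X'(1) Y'(1) by blast
qed

text \<open>Transporting the counits at \<open>X'\<close> and \<open>Y'\<close> along the given
  \<alpha> and \<beta> yields two faces of the cube by construction; functoriality of
  \<open>L\<close> yields the face opposite to the given square.\<close>

lemma transfer_structures:
  assumes X: "X \<in> mcSet A" and Y: "Y \<in> mcSet A" and f: "f \<in> mcHom A X Y"
    and X': "X' \<in> mcSet B" and Y': "Y' \<in> mcSet B" and f': "f' \<in> mcHom B X' Y'"
    and iso: "arrow_iso A (istar A X') (istar A Y') f' X Y f \<alpha> \<beta>"
  shows "\<exists>\<Gamma>X \<Gamma>Y. compatible_strong_structures A B L Lm \<eta> X Y f \<Gamma>X \<Gamma>Y \<and>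
    counit_cube A L Lm \<epsilon> X' Y' f' X Y f \<Gamma>X \<Gamma>Y \<alpha> \<beta>"
proof -
  note sX = istar_mcSet[OF AB X'] and sY = istar_mcSet[OF AB Y'] and sf = istar_mcHom[OF AB f']
  have \<alpha>: "\<alpha> \<in> mcIso A (istar A X') X" and \<beta>: "\<beta> \<in> mcIso A (istar A Y') Y"
    and square: "mcComp (istar A X') f \<alpha> = mcComp (istar A X') \<beta> f'"
    using iso unfolding arrow_iso_def by auto
  have h\<alpha>: "\<alpha> \<in> mcHom A (istar A X') X" and h\<beta>: "\<beta> \<in> mcHom A (istar A Y') Y"
    using \<alpha> \<beta> unfolding mcIso_def by auto
  have square': "f n (\<alpha> n x) = \<beta> n (f' n x)" if "x \<in> cubes X' n" for n x
    using arg_cong[OF square, of "\<lambda>h. h n x"] that by simp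
  obtain \<Gamma>X where \<Gamma>X: "strong_connection_structure A B (L X) (\<eta> X) X \<Gamma>X"
    "\<And>n z. z \<in> cubes (L (istar A X')) n \<Longrightarrow> \<Gamma>X n (Lm (istar A X') X \<alpha> n z) = \<alpha> n (\<epsilon> X' n z)"
    and onto: "\<And>n z. z \<in> cubes (L X) n \<Longrightarrow> \<exists>w\<in>cubes (L (istar A X')) n. z = Lm (istar A X') X \<alpha> n w"
    using transfer_strong_structure[OF X X' \<alpha>] by metis
  obtain \<Gamma>Y where \<Gamma>Y: "strong_connection_structure A B (L Y) (\<eta> Y) Y \<Gamma>Y"
    "\<And>n z. z \<in> cubes (L (istar A Y')) n \<Longrightarrow> \<Gamma>Y n (Lm (istar A Y') Y \<beta> n z) = \<beta> n (\<epsilon> Y' n z)"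
    using transfer_strong_structure[OF Y Y' \<beta>] by metis
  have L_square: "Lm X Y f n (Lm (istar A X') X \<alpha> n z) =
      Lm (istar A Y') Y \<beta> n (Lm (istar A X') (istar A Y') f' n z)"
    if "z \<in> cubes (L (istar A X')) n" for n z
    by (simp add: Lm_comp_apply[OF sX X Y h\<alpha> f that] Lm_comp_apply[OF sX sY Y sf h\<beta> that] square)
  \<comment> \<open>For \<open>z\<close> the image of \<open>w\<close>, both sides equal
    \<open>\<beta> n (f' n (\<epsilon> X' n w))\<close>: the left by \<open>square'\<close>, the
    right by \<open>L_square\<close> and naturality of the counit.\<close>
  have comm: "f n (\<Gamma>X n z) = \<Gamma>Y n (Lm X Y f n z)" if z: "z \<in> cubes (L X) n" for n z
  proof -
    obtain w where w: "w \<in> cubes (L (istar A X')) n" "z = Lm (istar A X') X \<alpha> n w"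
      using onto[OF z] by blast
    have "f n (\<Gamma>X n z) = \<beta> n (f' n (\<epsilon> X' n w))"
      using w hom_cubes[OF counit_hom[OF X'] w(1)] by (simp add: \<Gamma>X square')
    also have "\<dots> = \<Gamma>Y n (Lm X Y f n z)"
      using w hom_cubes[OF L_hom[OF sX sY sf] w(1)]
      by (simp add: L_square \<Gamma>Y counit_natural_apply[OF X' Y' f'])
    finally show ?thesis .
  qed
  have comm': "mcComp (L X) f \<Gamma>X = mcComp (L X) \<Gamma>Y (Lm X Y f)"
    by (rule cmap_eqI[where X="L X"]) (auto simp: comm)
  have "mcComp (L (istar A X')) \<Gamma>X (Lm (istar A X') X \<alpha>) = mcComp (L (istar A X')) \<alpha> (\<epsilon> X')"
    "mcComp (L (istar A X')) (Lm X Y f) (Lm (istar A X') X \<alpha>) =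
      mcComp (L (istar A X')) (Lm (istar A Y') Y \<beta>) (Lm (istar A X') (istar A Y') f')"
    by (rule cmap_eqI[where X="L (istar A X')"]; simp add: \<Gamma>X L_square)+
  moreover have "mcComp (L (istar A Y')) \<Gamma>Y (Lm (istar A Y') Y \<beta>) = mcComp (L (istar A Y')) \<beta> (\<epsilon> Y')"
    by (rule cmap_eqI[where X="L (istar A Y')"]; simp add: \<Gamma>Y)
  ultimately show ?thesis
    using \<Gamma>X(1) \<Gamma>Y(1) comm' square counit_natural[OF X' Y' f']
    unfolding compatible_strong_structures_def counit_cube_def Let_def by blast
qed

end

theorem proposition3p2:
  fixes A B :: "bool set"
    and L :: "'u mcset \<Rightarrow> 'u mcset"
    and Lm :: "'u mcset \<Rightarrow> 'u mcset \<Rightarrow> 'u cmap \<Rightarrow> 'u cmap"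
    and \<eta> \<epsilon> :: "'u mcset \<Rightarrow> 'u cmap"
    and X Y :: "'u mcset" and f :: "'u cmap"
  assumes "A \<subseteq> B"
    and "box_adjunction A B L Lm \<eta> \<epsilon>"
    and "X \<in> mcSet A" and "Y \<in> mcSet A" and "f \<in> mcHom A X Y"
  shows "((\<exists>X'\<in>mcSet B. \<exists>Y'\<in>mcSet B. \<exists>f'\<in>mcHom B X' Y'. \<exists>\<alpha> \<beta>.
             arrow_iso A (istar A X') (istar A Y') f' X Y f \<alpha> \<beta>) \<longleftrightarrow>
          (\<exists>\<Gamma>X \<Gamma>Y. compatible_strong_structures A B L Lm \<eta> X Y f \<Gamma>X \<Gamma>Y)) \<and>
         (\<forall>\<Gamma>X \<Gamma>Y. compatible_strong_structures A B L Lm \<eta> X Y f \<Gamma>X \<Gamma>Y \<longrightarrow>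
            (\<exists>X'\<in>mcSet B. \<exists>Y'\<in>mcSet B. \<exists>f'\<in>mcHom B X' Y'. \<exists>\<alpha> \<beta>.
               arrow_iso A (istar A X') (istar A Y') f' X Y f \<alpha> \<beta> \<and>
               counit_cube A L Lm \<epsilon> X' Y' f' X Y f \<Gamma>X \<Gamma>Y \<alpha> \<beta>)) \<and>
         (\<forall>X'\<in>mcSet B. \<forall>Y'\<in>mcSet B. \<forall>f'\<in>mcHom B X' Y'. \<forall>\<alpha> \<beta>.
            arrow_iso A (istar A X') (istar A Y') f' X Y f \<alpha> \<beta> \<longrightarrow>
            (\<exists>\<Gamma>X \<Gamma>Y. compatible_strong_structures A B L Lm \<eta> X Y f \<Gamma>X \<Gamma>Y \<and>
               counit_cube A L Lm \<epsilon> X' Y' f' X Y f \<Gamma>X \<Gamma>Y \<alpha> \<beta>))"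
proof -
  interpret box_inclusion_adjunction A B L Lm \<eta> \<epsilon>
    using assms(1,2) by (simp add: box_inclusion_adjunction_def box_inclusion_adjunction_axioms_def)
  \<comment> \<open>The two directions of the equivalence are these two results with the cube
    forgotten.\<close>
  note strict_lift[OF assms(3-5)] transfer_structures[OF assms(3-5)]
  then show ?thesis by blast
qed

end
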